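(* Let $V$ be a vector space and $f:V\to V$ a linear endomorphism. Let $i\ge 1$, $k\ge 0$, $x_1,\ldots,x_i\in V$, $w_1,\ldots,w_k\in T(V,f)$, and let $w=x_1\ldots x_i$. For pairwise disjoint subsets $I_1,\ldots,I_i$ of $\{1,\ldots,k\}$, put $$R(I_1,\ldots,I_i)=f^{|I_1|}(x_1)\Big(f^{|I_2|}(x_2)\big(\ldots\big(f^{|I_i|}(x_i)\,w_{I_i}^{\sqcup\!\sqcup}\big)\sqcup\!\sqcup w_{I_{i-1}}^{\sqcup\!\sqcup}\ldots\big)\sqcup\!\sqcup w_{I_1}^{\sqcup\!\sqcup}\Big),$$ that is, $R(I_1,\ldots,I_i)=R_1$ where $R_i=f^{|I_i|}(x_i)\,w_{I_i}^{\sqcup\!\sqcup}$ and $R_j=f^{|I_j|}(x_j)\,(R_{j+1}\sqcup\!\sqcup w_{I_j}^{\sqcup\!\sqcup})$ for $1\le j<i$. Then, in $S(T(V,f))$, $$w\bullet(w_1\times\ldots\times w_k)=\sum_{I_1\sqcup\ldots\sqcup I_i=\{1,\ldots,k\}}R(I_1,\ldots,I_i),$$ $$w\star(w_1\times\ldots\times w_k)=\sum_{I_1\sqcup\ldots\sqcup I_{i+1}=\{1,\ldots,k\}}R(I_1,\ldots,I_i)\times w_{I_{i+1}},$$ where the sums are over ordered decompositions of $\{1,\ldots,k\}$ into pairwise disjoint, possibly empty, subsets.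
   Context: $\mathbb{K}$ is a field of characteristic zero. For a vector space $V$, $T(V)=\bigoplus_{n\ge 0}V^{\otimes n}$ is spanned by words with letters in $V$; $\emptyset$ is the empty word; juxtaposition denotes concatenation. The shuffle product $\sqcup\!\sqcup$ is the bilinear (commutative, associative) product with unit $\emptyset$ and $xu\sqcup\!\sqcup yv=x(u\sqcup\!\sqcup yv)+y(xu\sqcup\!\sqcup v)$ for $x,y\in V$, $u,v\in T(V)$. The bilinear product $\bullet$ on $T(V)$ is defined by $\emptyset\bullet w'=0$ and $(xw)\bullet w'=x(w\bullet w')+f(x)(w\sqcup\!\sqcup w')$ for $x\in V$, $w,w'\in T(V)$. It is a right pre-Lie product, and $T(V,f)$ denotes $T(V)$ with it. $S(T(V,f))$ is the symmetric algebra of the vector space $T(V,f)$, with product denoted $\times$ and unit $1$ (distinct from $\emptyset$), and with the usual coproduct $\Delta(z)=z^{(1)}\otimes z^{(2)}$, the algebra morphism for which elements of $T(V,f)$ are primitive. Following Oudom and Guin, $\bullet$ is extended to $S(T(V,f))\otimes S(T(V,f))\to S(T(V,f))$ by: $y\bullet 1=y$ for all $y\in S(T(V,f))$; $1\bullet z=\varepsilon(z)1$, where $\varepsilon$ is the counit; for $u,u_1,\ldots,u_k\in T(V,f)$, $u\bullet(u_1\times\ldots\times u_k)=(u\bullet(u_1\times\ldots\times u_{k-1}))\bullet u_k-u\bullet((u_1\times\ldots\times u_{k-1})\bullet u_k)$; and $(y\times y')\bullet z=(y\bullet z^{(1)})\times(y'\bullet z^{(2)})$. The associative product $\star$ is $y\star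 z=(y\bullet z^{(1)})\times z^{(2)}$. For $I=\{i_1,\ldots,i_p\}\subseteq\{1,\ldots,k\}$: $w_I=w_{i_1}\times\ldots\times w_{i_p}\in S(T(V,f))$ and $w_I^{\sqcup\!\sqcup}=w_{i_1}\sqcup\!\sqcup\ldots\sqcup\!\sqcup w_{i_p}\in T(V,f)$, with $w_I=1$ and $w_I^{\sqcup\!\sqcup}=\emptyset$ (the empty word) if $I$ is empty. *)

theory Defs
  imports
    Complex_Main
    "HOL-Library.Poly_Mapping"
    "HOL-Library.Multiset"
    "HOL-Library.Product_Plus"
    "HOL-Library.FuncSet"
    "HOL-Library.Disjoint_Sets"
begin

section \<open>Formal linear combinations\<close>

definition pscale :: "'k::field \<Rightarrow> ('a \<Rightarrow>\<^sub>0 'k) \<Rightarrow> 'a \<Rightarrow>\<^sub>0 'k" where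
  "pscale c p = Poly_Mapping.map ((*) c) p"

abbreviation bas :: "'a \<Rightarrow> 'a \<Rightarrow>\<^sub>0 'k::field" where
  "bas a \<equiv> Poly_Mapping.single a 1"

abbreviation lin :: "(('a \<Rightarrow>\<^sub>0 'k::field) \<Rightarrow> ('b \<Rightarrow>\<^sub>0 'k)) \<Rightarrow> bool" where
  "lin h \<equiv> Vector_Spaces.linear pscale pscale h"

definition lin_ext :: "('a \<Rightarrow> 'b \<Rightarrow>\<^sub>0 'k::field) \<Rightarrow> ('a \<Rightarrow>\<^sub>0 'k) \<Rightarrow> 'b \<Rightarrow>\<^sub>0 'k" where
  "lin_ext g p = (\<Sum>a\<in>Poly_Mapping.keys p. pscale (Poly_Mapping.lookup p a) (g a))"

definition bilin_ext ::
  "('a \<Rightarrow> 'b \<Rightarrow> 'c \<Rightarrow>\<^sub>0 'k::field) \<Rightarrow> ('a \<Rightarrow>\<^sub>0 'k) \<Rightarrow> ('b \<Rightarrow>\<^sub>0 'k) \<Rightarrow> 'c \<Rightarrow>\<^sub>0 'k" where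
  "bilin_ext g p q = lin_ext (\<lambda>a. lin_ext (g a) q) p"


section \<open>The tensor algebra of a vector space\<close>

text \<open>
  The vector space is a type \<open>'v\<close> with a scalar multiplication \<open>scale\<close>. A type cannot depend on
  \<open>scale\<close>, so the tensor algebra is realised relative to a basis \<open>B\<close>: the words with letters in \<open>B\<close>
  are a basis of \<open>T(V)\<close>, and a word with arbitrary letters in \<open>V\<close> is expanded multilinearly along
  \<open>B\<close>. The operations below are defined on all of \<open>'v list \<Rightarrow>\<^sub>0 'k\<close>; the elements of \<open>T(V)\<close> are
  those supported on words over \<open>B\<close> (\<open>tensor_space B\<close>).
\<close>

type_synonym ('v, 'k) tens = "'v list \<Rightarrow>\<^sub>0 'k"

definition is_basis :: "('k::field \<Rightarrow> 'v::ab_group_add \<Rightarrow> 'v) \<Rightarrow> 'v set \<Rightarrow> bool" where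
  "is_basis scale B \<longleftrightarrow> \<not> module.dependent scale B \<and> module.span scale B = UNIV"

definition tensor_space :: "'v set \<Rightarrow> ('v, 'k::field) tens set" where
  "tensor_space B = {p. Poly_Mapping.keys p \<subseteq> lists B}"

definition letter :: "('k::field \<Rightarrow> 'v::ab_group_add \<Rightarrow> 'v) \<Rightarrow> 'v set \<Rightarrow> 'v \<Rightarrow> 'v \<Rightarrow>\<^sub>0 'k" where
  "letter scale B x =
    (\<Sum>b | module.representation scale B x b \<noteq> 0.
      Poly_Mapping.single b (module.representation scale B x b))"

text \<open>Concatenation \<open>x p\<close> of a letter (given by its coordinates) and an element of the tensor algebra.\<close>

definition prepend :: "('v \<Rightarrow>\<^sub>0 'k::field) \<Rightarrow> ('v, 'k) tens \<Rightarrow> ('v, 'k) tens" where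
  "prepend = bilin_ext (\<lambda>a u. bas (a # u))"

definition word :: "('k::field \<Rightarrow> 'v::ab_group_add \<Rightarrow> 'v) \<Rightarrow> 'v set \<Rightarrow> 'v list \<Rightarrow> ('v, 'k) tens" where
  "word scale B xs = foldr (\<lambda>x p. prepend (letter scale B x) p) xs (bas [])"

text \<open>
  The recursions for the shuffle product and the pre-Lie product are stated on words over the basis
  and extended bilinearly; for letters in \<open>V\<close> they are the lemmas \<open>shuffle_prepend\<close> and
  \<open>prelie_letter\<close> below.
\<close>

fun shuffle_words :: "'v list \<Rightarrow> 'v list \<Rightarrow> ('v, 'k::field) tens" where
  "shuffle_words [] v = bas v"
| "shuffle_words (a # u) [] = bas (a # u)"
| "shuffle_words (a # u) (b # v) =
    prepend (bas a) (shuffle_words u (b # v)) + prepend (bas b) (shuffle_words (a # u) v)"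

definition shuffle :: "('v, 'k::field) tens \<Rightarrow> ('v, 'k) tens \<Rightarrow> ('v, 'k) tens" where
  "shuffle = bilin_ext shuffle_words"

fun prelie_words ::
  "('k::field \<Rightarrow> 'v::ab_group_add \<Rightarrow> 'v) \<Rightarrow> 'v set \<Rightarrow> ('v \<Rightarrow> 'v) \<Rightarrow> 'v list \<Rightarrow> 'v list \<Rightarrow> ('v, 'k) tens"
where
  "prelie_words scale B f [] v = 0"
| "prelie_words scale B f (a # u) v =
    prepend (bas a) (prelie_words scale B f u v) +
    prepend (letter scale B (f a)) (shuffle_words u v)"

definition prelie ::
  "('k::field \<Rightarrow> 'v::ab_group_add \<Rightarrow> 'v) \<Rightarrow> 'v set \<Rightarrow> ('v \<Rightarrow> 'v) \<Rightarrow>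
    ('v, 'k) tens \<Rightarrow> ('v, 'k) tens \<Rightarrow> ('v, 'k) tens" where
  "prelie scale B f = bilin_ext (prelie_words scale B f)"


section \<open>The symmetric algebra\<close>

text \<open>
  The symmetric algebra of \<open>'a \<Rightarrow>\<^sub>0 'k\<close> is the polynomial algebra on \<open>'a\<close>: its basis consists of the
  multisets over \<open>'a\<close>, its product is the convolution product \<open>*\<close>, and \<open>iota\<close> is the inclusion of
  the generating space. The tensor square of this algebra is the convolution algebra over the
  product monoid.
\<close>

type_synonym ('a, 'k) sym = "'a multiset \<Rightarrow>\<^sub>0 'k"
type_synonym ('a, 'k) sym2 = "('a multiset \<times> 'a multiset) \<Rightarrow>\<^sub>0 'k"

definition iota :: "('a \<Rightarrow>\<^sub>0 'k::field) \<Rightarrow> ('a, 'k) sym" where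
  "iota = lin_ext (\<lambda>a. bas {#a#})"

definition counit :: "('a, 'k::field) sym \<Rightarrow> 'k" where
  "counit z = Poly_Mapping.lookup z {#}"

definition coproduct :: "('a, 'k::field) sym \<Rightarrow> ('a, 'k) sym2" where
  "coproduct = lin_ext (\<lambda>M. \<Prod>a\<in>#M. bas ({#a#}, {#}) + bas ({#}, {#a#}))"

text \<open>
  The linear map on the tensor square induced by a bilinear \<open>g\<close>, so that
  \<open>sweedler g (coproduct z)\<close> is \<open>g z\<^sup>(\<^sup>1\<^sup>) z\<^sup>(\<^sup>2\<^sup>)\<close> in Sweedler notation.
\<close>

definition sweedler ::
  "(('a, 'k::field) sym \<Rightarrow> ('a, 'k) sym \<Rightarrow> 'b \<Rightarrow>\<^sub>0 'k) \<Rightarrow> ('a, 'k) sym2 \<Rightarrow> 'b \<Rightarrow>\<^sub>0 'k" where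
  "sweedler g = lin_ext (\<lambda>(M, N). g (bas M) (bas N))"


section \<open>The Oudom-Guin extension of a pre-Lie product\<close>

definition oudom_guin_extension ::
  "(('a \<Rightarrow>\<^sub>0 'k::field) \<Rightarrow> ('a \<Rightarrow>\<^sub>0 'k) \<Rightarrow> 'a \<Rightarrow>\<^sub>0 'k) \<Rightarrow>
    (('a, 'k) sym \<Rightarrow> ('a, 'k) sym \<Rightarrow> ('a, 'k) sym) \<Rightarrow> bool" where
  "oudom_guin_extension pl bul \<longleftrightarrow>
    (\<forall>y. lin (bul y)) \<and> (\<forall>z. lin (\<lambda>y. bul y z)) \<and>
    (\<forall>u v. bul (iota u) (iota v) = iota (pl u v)) \<and>
    (\<forall>y. bul y 1 = y) \<and>
    (\<forall>z. bul 1 z = pscale (counit z) 1) \<and>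
    (\<forall>u us v. bul (iota u) (prod_list (map iota us) * iota v) =
       bul (bul (iota u) (prod_list (map iota us))) (iota v) -
       bul (iota u) (bul (prod_list (map iota us)) (iota v))) \<and>
    (\<forall>y y' z. bul (y * y') z = sweedler (\<lambda>z1 z2. bul y z1 * bul y' z2) (coproduct z))"

text \<open>
  For the pre-Lie product of the tensor algebra the extension exists and is unique; this is lemma
  \<open>ex1_oudom_guin_extension\<close> below.
\<close>

definition bullet ::
  "(('a \<Rightarrow>\<^sub>0 'k::field) \<Rightarrow> ('a \<Rightarrow>\<^sub>0 'k) \<Rightarrow> 'a \<Rightarrow>\<^sub>0 'k) \<Rightarrow> ('a, 'k) sym \<Rightarrow> ('a, 'k) sym \<Rightarrow> ('a, 'k) sym"
where
  "bullet pl = (THE bul. oudom_guin_extension pl bul)"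

definition star ::
  "(('a \<Rightarrow>\<^sub>0 'k::field) \<Rightarrow> ('a \<Rightarrow>\<^sub>0 'k) \<Rightarrow> 'a \<Rightarrow>\<^sub>0 'k) \<Rightarrow> ('a, 'k) sym \<Rightarrow> ('a, 'k) sym \<Rightarrow> ('a, 'k) sym"
where
  "star pl y z = sweedler (\<lambda>z1 z2. bullet pl y z1 * z2) (coproduct z)"


section \<open>The right-hand sides\<close>

definition shuffle_family :: "(nat \<Rightarrow> ('v, 'k::field) tens) \<Rightarrow> nat set \<Rightarrow> ('v, 'k) tens" where
  "shuffle_family w I = foldr (\<lambda>j t. shuffle (w j) t) (sorted_list_of_set I) (bas [])"

function nested ::
  "('k::field \<Rightarrow> 'v::ab_group_add \<Rightarrow> 'v) \<Rightarrow> 'v set \<Rightarrow> ('v \<Rightarrow> 'v) \<Rightarrow> (nat \<Rightarrow> 'v) \<Rightarrow>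
    (nat \<Rightarrow> ('v, 'k) tens) \<Rightarrow> (nat \<Rightarrow> nat set) \<Rightarrow> nat \<Rightarrow> nat \<Rightarrow> ('v, 'k) tens" where
  "nested scale B f x w I i j =
    prepend (letter scale B ((f ^^ card (I j)) (x j)))
      (if j < i then shuffle (nested scale B f x w I i (Suc j)) (shuffle_family w (I j))
       else shuffle_family w (I j))"
  by pat_completeness auto
termination
  by (relation "measure (\<lambda>(scale, B, f, x, w, I, i, j). i - j)") auto

declare nested.simps [simp del]

text \<open>Ordered decompositions of \<open>{1..k}\<close> into \<open>p\<close> pairwise disjoint, possibly empty, subsets.\<close>

definition decompositions :: "nat \<Rightarrow> nat \<Rightarrow> (nat \<Rightarrow> nat set) set" where
  "decompositions p k =
    {I \<in> {1..p} \<rightarrow>\<^sub>E Pow {1..k}. disjoint_family_on I {1..p} \<and> (\<Union>j\<in>{1..p}. I j) = {1..k}}"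


section \<open>Linear maps between spaces of formal linear combinations\<close>

lemma lookup_pscale [simp]: "Poly_Mapping.lookup (pscale c p) a = c * Poly_Mapping.lookup p a"
  unfolding pscale_def by (auto simp: Poly_Mapping.map.rep_eq when_def)

lemma pscale_simps [simp]:
  "pscale 1 p = p" "pscale 0 p = 0" "pscale c 0 = 0"
  by (rule poly_mapping_eqI, simp)+

lemma pscale_single [simp]: "pscale c (Poly_Mapping.single a d) = Poly_Mapping.single a (c * d)"
  by (rule poly_mapping_eqI) (simp add: lookup_single when_def)

lemma pscale_add_right: "pscale c (p + q) = pscale c p + pscale c q"
  and pscale_add_left: "pscale (c + d) p = pscale c p + pscale d p"
  and pscale_diff_right: "pscale c (p - q) = pscale c p - pscale c q"
  and pscale_pscale: "pscale c (pscale d p) = pscale (c * d) p"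
  by (rule poly_mapping_eqI, simp add: lookup_add lookup_minus algebra_simps)+

interpretation pm: vector_space "pscale :: 'k::field \<Rightarrow> ('a \<Rightarrow>\<^sub>0 'k) \<Rightarrow> _"
  by unfold_locales (simp_all add: pscale_add_right pscale_add_left pscale_pscale)

lemma pscale_eq_times:
  fixes p :: "'a::comm_monoid_add \<Rightarrow>\<^sub>0 'k::field"
  shows "pscale c p = Poly_Mapping.single 0 c * p"
  unfolding pscale_def by (rule mult_map_scale_conv_mult)

lemma pscale_mult:
  fixes p q :: "'a::comm_monoid_add \<Rightarrow>\<^sub>0 'k::field"
  shows "pscale c p * q = pscale c (p * q)" "p * pscale c q = pscale c (p * q)"
  by (simp_all add: pscale_eq_times mult_ac)

lemma linI:
  assumes "\<And>p q. h (p + q) = h p + h q" "\<And>c p. h (pscale c p) = pscale c (h p)"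
  shows "lin h"
  by unfold_locales (use assms in auto)

lemma lin_add: "lin h \<Longrightarrow> h (p + q) = h p + h q"
  by (simp add: Vector_Spaces.linear_def module_hom_def module_hom_axioms_def
      linear_iff_module_hom)

lemma lin_scale: "lin h \<Longrightarrow> h (pscale c p) = pscale c (h p)"
  by (simp add: Vector_Spaces.linear_def module_hom_def module_hom_axioms_def
      linear_iff_module_hom)

lemma lin_0: "lin h \<Longrightarrow> h 0 = 0"
  using lin_scale[of h 0 0] by simp

lemma lin_diff: "lin h \<Longrightarrow> h (p - q) = h p - h q"
  by (metis add_diff_cancel diff_add_cancel lin_add)

lemma lin_sum: "lin h \<Longrightarrow> h (sum g A) = (\<Sum>a\<in>A. h (g a))"
  by (induction A rule: infinite_finite_induct) (simp_all add: lin_0 lin_add)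

lemma poly_mapping_expand: "p = (\<Sum>a\<in>Poly_Mapping.keys p. pscale (Poly_Mapping.lookup p a) (bas a))"
proof (rule poly_mapping_eqI)
  fix b
  have "Poly_Mapping.lookup (\<Sum>a\<in>Poly_Mapping.keys p. pscale (Poly_Mapping.lookup p a) (bas a)) b =
     (\<Sum>a\<in>Poly_Mapping.keys p. if a = b then Poly_Mapping.lookup p b else 0)"
    unfolding lookup_sum by (intro sum.cong) (auto simp: lookup_single when_def)
  then show "Poly_Mapping.lookup p b =
      Poly_Mapping.lookup (\<Sum>a\<in>Poly_Mapping.keys p. pscale (Poly_Mapping.lookup p a) (bas a)) b"
    by (simp add: in_keys_iff)
qed

lemma lin_eq_lin_ext: "lin h \<Longrightarrow> h p = lin_ext (\<lambda>a. h (bas a)) p"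
  by (subst poly_mapping_expand[of p]) (simp add: lin_sum lin_scale lin_ext_def del: pscale_single)

lemma lin_eqI: "lin h \<Longrightarrow> lin g \<Longrightarrow> (\<And>a. h (bas a) = g (bas a)) \<Longrightarrow> h p = g p"
  using lin_eq_lin_ext[of h p] lin_eq_lin_ext[of g p] by presburger

lemma lin_ext_superset:
  assumes "finite A" "Poly_Mapping.keys p \<subseteq> A"
  shows "lin_ext g p = (\<Sum>a\<in>A. pscale (Poly_Mapping.lookup p a) (g a))"
  unfolding lin_ext_def
  by (rule sum.mono_neutral_left) (use assms in \<open>auto simp: in_keys_iff\<close>)

lemma lin_lin_ext_id:
  fixes g :: "'a \<Rightarrow> 'b \<Rightarrow>\<^sub>0 'k::field"
  shows "lin (lin_ext g)"
proof (rule linI)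
  fix p q :: "'a \<Rightarrow>\<^sub>0 'k" and c :: 'k
  let ?A = "Poly_Mapping.keys p \<union> Poly_Mapping.keys q"
  have "finite ?A" by simp
  moreover have "Poly_Mapping.keys (p + q) \<subseteq> ?A" by (rule keys_add)
  ultimately show "lin_ext g (p + q) = lin_ext g p + lin_ext g q"
    by (simp add: lin_ext_superset[of ?A] lookup_add pscale_add_left sum.distrib)
  have "Poly_Mapping.keys (pscale c p) \<subseteq> Poly_Mapping.keys p"
    by (auto simp: in_keys_iff)
  then show "lin_ext g (pscale c p) = pscale c (lin_ext g p)"
    by (simp add: lin_ext_superset[of "Poly_Mapping.keys p"] pm.scale_sum_right)
qed

lemma lin_ext_bas [simp]: "lin_ext g (bas a) = g a"
  by (simp add: lin_ext_def)

lemma lin_id: "lin (\<lambda>x. x)"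
  and lin_zero: "lin (\<lambda>x. 0)"
  by (rule linI; simp)+

lemma lin_comp: "lin g \<Longrightarrow> lin h \<Longrightarrow> lin (\<lambda>x. g (h x))"
  by (rule linI) (simp_all add: lin_add lin_scale)

lemma lin_plus: "lin g \<Longrightarrow> lin h \<Longrightarrow> lin (\<lambda>x. g x + h x)"
  by (rule linI) (simp_all add: lin_add lin_scale pscale_add_right)

lemma lin_minus: "lin g \<Longrightarrow> lin h \<Longrightarrow> lin (\<lambda>x. g x - h x)"
  by (rule linI) (simp_all add: lin_add lin_scale pscale_diff_right)

lemma lin_pscale: "lin h \<Longrightarrow> lin (\<lambda>x. pscale c (h x))"
  by (rule linI) (simp_all add: lin_add lin_scale pscale_add_right pscale_pscale mult.commute)

lemma lin_lin_ext: "lin h \<Longrightarrow> lin (\<lambda>x. lin_ext g (h x))"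
  by (rule lin_comp[OF lin_lin_ext_id])

lemma lin_lin_ext_fun:
  assumes "\<And>a. lin (\<lambda>x. g x a)"
  shows "lin (\<lambda>x. lin_ext (g x) p)"
proof -
  have "g (x + y) a = g x a + g y a" "g (pscale c x) a = pscale c (g x a)" for x y c a
    using lin_add[OF assms] lin_scale[OF assms] by auto
  then show ?thesis
    by (intro linI) (simp_all add: lin_ext_def pscale_add_right sum.distrib
        pscale_pscale pm.scale_sum_right mult.commute)
qed

lemma lin_times:
  fixes h :: "('a \<Rightarrow>\<^sub>0 'k) \<Rightarrow> ('b::comm_monoid_add \<Rightarrow>\<^sub>0 'k::field)"
  shows "lin h \<Longrightarrow> lin (\<lambda>x. h x * q)" "lin h \<Longrightarrow> lin (\<lambda>x. q * h x)"
  by (rule linI; simp add: lin_add lin_scale pscale_mult algebra_simps)+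

lemma lin_bilin_ext:
  "lin h \<Longrightarrow> lin (\<lambda>x. bilin_ext g (h x) q)" "lin h' \<Longrightarrow> lin (\<lambda>x. bilin_ext g p (h' x))"
  unfolding bilin_ext_def by (intro lin_lin_ext lin_lin_ext_fun; assumption)+

lemma lin_counit: "lin h \<Longrightarrow> lin (\<lambda>x. pscale (counit (h x)) q)"
  by (rule linI) (simp_all add: counit_def lin_add lin_scale lookup_add pscale_add_left pscale_pscale)

lemma bilin_ext_bas [simp]: "bilin_ext g (bas a) (bas b) = g a b"
  by (simp add: bilin_ext_def)

lemma lin_prepend:
  "lin h \<Longrightarrow> lin (\<lambda>x. prepend (h x) q)" "lin h' \<Longrightarrow> lin (\<lambda>x. prepend l (h' x))"
  unfolding prepend_def by (rule lin_bilin_ext, assumption)+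

lemma lin_shuffle: "lin h \<Longrightarrow> lin (\<lambda>x. shuffle (h x) q)" "lin h \<Longrightarrow> lin (\<lambda>x. shuffle q (h x))"
  unfolding shuffle_def by (rule lin_bilin_ext, assumption)+

lemma lin_prelie:
  "lin h \<Longrightarrow> lin (\<lambda>x. prelie scale B f (h x) q)" "lin h \<Longrightarrow> lin (\<lambda>x. prelie scale B f q (h x))"
  unfolding prelie_def by (rule lin_bilin_ext, assumption)+

lemma lin_iota: "lin h \<Longrightarrow> lin (\<lambda>x. iota (h x))"
  unfolding iota_def by (rule lin_lin_ext)

lemma lin_coproduct: "lin h \<Longrightarrow> lin (\<lambda>x. coproduct (h x))"
  unfolding coproduct_def by (rule lin_lin_ext)

lemma lin_sweedler: "lin h \<Longrightarrow> lin (\<lambda>x. sweedler g (h x))"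
  unfolding sweedler_def by (rule lin_lin_ext)

lemma lin_sweedler_fun: "(\<And>a b. lin (\<lambda>x. g x a b)) \<Longrightarrow> lin (\<lambda>x. sweedler (g x) p)"
  unfolding sweedler_def by (intro lin_lin_ext_fun) auto

lemmas lin_intros = lin_id lin_zero lin_plus lin_minus lin_pscale lin_lin_ext lin_times lin_prepend
  lin_shuffle lin_prelie lin_iota lin_coproduct lin_sweedler lin_sweedler_fun lin_counit
  lin_bilin_ext

section \<open>Rules for letters in \<open>V\<close> and the pre-Lie structure\<close>

lemma prepend_bas [simp]: "prepend (bas a) (bas u) = bas (a # u)"
  by (simp add: prepend_def)

lemma prepend_simps:
  "prepend (l + l') p = prepend l p + prepend l' p"
  "prepend l (p + q) = prepend l p + prepend l q"
  "prepend l (p - q) = prepend l p - prepend l q"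
  "prepend l 0 = 0" "prepend 0 p = 0"
  by (rule lin_add lin_diff lin_0, intro lin_intros)+

lemma shuffle_simps:
  "shuffle (p + p') q = shuffle p q + shuffle p' q"
  "shuffle p (q + q') = shuffle p q + shuffle p q'"
  "shuffle (p - p') q = shuffle p q - shuffle p' q"
  "shuffle p (q - q') = shuffle p q - shuffle p q'"
  "shuffle p 0 = 0" "shuffle 0 p = 0"
  by (rule lin_add lin_diff lin_0, intro lin_intros)+

lemma prelie_simps:
  "prelie scale B f (p + p') q = prelie scale B f p q + prelie scale B f p' q"
  "prelie scale B f p (q + q') = prelie scale B f p q + prelie scale B f p q'"
  "prelie scale B f (p - p') q = prelie scale B f p q - prelie scale B f p' q"
  "prelie scale B f p (q - q') = prelie scale B f p q - prelie scale B f p q'"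
  "prelie scale B f p 0 = 0" "prelie scale B f 0 p = 0"
  by (rule lin_add lin_diff lin_0, intro lin_intros)+

lemma shuffle_Nil_left [simp]: "shuffle (bas []) p = p"
proof (rule lin_eqI[of "\<lambda>p. shuffle (bas []) p" "\<lambda>p. p"])
  show "shuffle (bas []) (bas a) = bas a" for a :: "'a list"
    by (simp add: shuffle_def)
qed (intro lin_intros)+

lemma shuffle_Nil_right [simp]: "shuffle p (bas []) = p"
proof (rule lin_eqI[of "\<lambda>p. shuffle p (bas [])" "\<lambda>p. p"])
  show "shuffle (bas a) (bas []) = bas a" for a :: "'a list"
    by (cases a) (simp_all add: shuffle_def)
qed (intro lin_intros)+

lemma shuffle_bas: "shuffle (bas u) (bas v) = shuffle_words u v"
  by (simp add: shuffle_def)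

lemma shuffle_prepend:
  "shuffle (prepend l p) (prepend m q) =
     prepend l (shuffle p (prepend m q)) + prepend m (shuffle (prepend l p) q)"
proof -
  have 1: "shuffle (prepend (bas a) (bas u)) (prepend (bas b) (bas v)) =
     prepend (bas a) (shuffle (bas u) (prepend (bas b) (bas v))) +
     prepend (bas b) (shuffle (prepend (bas a) (bas u)) (bas v))" for a b :: 'a and u v
    by (simp add: shuffle_bas)
  have 2: "shuffle (prepend l (bas u)) (prepend (bas b) (bas v)) =
     prepend l (shuffle (bas u) (prepend (bas b) (bas v))) +
     prepend (bas b) (shuffle (prepend l (bas u)) (bas v))" for b u v
    by (rule lin_eqI[where p = l]) (intro lin_intros 1)+
  have 3: "shuffle (prepend l p) (prepend (bas b) (bas v)) =
     prepend l (shuffle p (prepend (bas b) (bas v))) +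
     prepend (bas b) (shuffle (prepend l p) (bas v))" for b v
    by (rule lin_eqI[where p = p]) (intro lin_intros 2)+
  have 4: "shuffle (prepend l p) (prepend m (bas v)) =
     prepend l (shuffle p (prepend m (bas v))) +
     prepend m (shuffle (prepend l p) (bas v))" for v
    by (rule lin_eqI[where p = m]) (intro lin_intros 3)+
  show ?thesis
    by (rule lin_eqI[where p = q]) (intro lin_intros 4)+
qed

lemma shuffle_words_commute: "shuffle_words u v = shuffle_words v u"
proof (induction u v rule: shuffle_words.induct)
  case (1 v) then show ?case by (cases v) auto
qed (auto simp: add.commute)

lemma shuffle_commute: "shuffle p q = shuffle q p"
proof -
  have 1: "shuffle (bas u) (bas v) = shuffle (bas v) (bas u)" for u v :: "'a list"
    unfolding shuffle_bas by (rule shuffle_words_commute)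
  have 2: "shuffle p (bas v) = shuffle (bas v) p" for v
    by (rule lin_eqI[where p = p]) (intro lin_intros 1)+
  show ?thesis
    by (rule lin_eqI[where p = q]) (intro lin_intros 2)+
qed

lemma shuffle_assoc_step:
  fixes l m n p q r
  defines "U \<equiv> prepend l p" and "V \<equiv> prepend m q" and "W \<equiv> prepend n r"
  shows "shuffle (shuffle U V) W = prepend l (shuffle (shuffle p V) W) +
      prepend m (shuffle (shuffle U q) W) + prepend n (shuffle (shuffle U V) r)"
    and "shuffle U (shuffle V W) = prepend l (shuffle p (shuffle V W)) +
      prepend m (shuffle U (shuffle q W)) + prepend n (shuffle U (shuffle V r))"
  unfolding U_def V_def W_def
  by (simp_all add: shuffle_prepend shuffle_simps prepend_simps add_ac)

lemma shuffle_assoc_words: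
  "shuffle (shuffle (bas u) (bas v)) (bas w) =
    shuffle (bas u) (shuffle (bas v) (bas w) :: ('v, 'k::field) tens)"
proof (induction "length u + length v + length w" arbitrary: u v w rule: less_induct)
  case less
  show ?case
  proof (cases "u = [] \<or> v = [] \<or> w = []")
    case False
    then obtain a u' b v' c w' where e: "u = a # u'" "v = b # v'" "w = c # w'"
      by (metis neq_Nil_conv)
    have 1: "shuffle (shuffle (bas u') (bas v)) (bas w) =
        shuffle (bas u') (shuffle (bas v) (bas w) :: ('v, 'k) tens)"
      and 2: "shuffle (shuffle (bas u) (bas v')) (bas w) =
        shuffle (bas u) (shuffle (bas v') (bas w) :: ('v, 'k) tens)"
      and 3: "shuffle (shuffle (bas u) (bas v)) (bas w') =
        shuffle (bas u) (shuffle (bas v) (bas w') :: ('v, 'k) tens)"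
      by (rule less; use e in simp)+
    show ?thesis
      using shuffle_assoc_step[of "bas a" "bas u'" "bas b" "bas v'" "bas c" "bas w' :: ('v, 'k) tens"]
      unfolding prepend_bas e[symmetric] 1 2 3 by (simp only:)
  qed auto
qed

lemma shuffle_assoc: "shuffle (shuffle p q) r = shuffle p (shuffle q r)"
proof -
  have 1: "shuffle (shuffle p (bas v)) (bas w) = shuffle p (shuffle (bas v) (bas w))" for v w
    by (rule lin_eqI[where p = p]) (intro lin_intros shuffle_assoc_words)+
  have 2: "shuffle (shuffle p q) (bas w) = shuffle p (shuffle q (bas w))" for w
    by (rule lin_eqI[where p = q]) (intro lin_intros 1)+
  show ?thesis
    by (rule lin_eqI[where p = r]) (intro lin_intros 2)+
qed

lemma shuffle_right_commute: "shuffle (shuffle t p) q = shuffle (shuffle t q) p"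
  by (metis shuffle_assoc shuffle_commute)

definition lmap ::
  "('k::field \<Rightarrow> 'v::ab_group_add \<Rightarrow> 'v) \<Rightarrow> 'v set \<Rightarrow> ('v \<Rightarrow> 'v) \<Rightarrow> ('v \<Rightarrow>\<^sub>0 'k) \<Rightarrow> 'v \<Rightarrow>\<^sub>0 'k" where
  "lmap scale B f = lin_ext (\<lambda>a. letter scale B (f a))"

lemma lin_lmap: "lin h \<Longrightarrow> lin (\<lambda>x. lmap scale B f (h x))"
  unfolding lmap_def by (rule lin_lin_ext)

lemma lin_lmap_funpow: "lin h \<Longrightarrow> lin (\<lambda>x. (lmap scale B f ^^ n) (h x))"
  by (induction n) (auto intro: lin_lmap)

lemma prelie_bas: "prelie scale B f (bas u) (bas v) = prelie_words scale B f u v"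
  by (simp add: prelie_def)

lemma prelie_Nil [simp]: "prelie scale B f (bas []) q = 0"
  by (rule lin_eqI[where p = q]) ((intro lin_intros)+, simp add: prelie_bas)

lemma prelie_prepend:
  "prelie scale B f (prepend l p) q =
     prepend l (prelie scale B f p q) + prepend (lmap scale B f l) (shuffle p q)"
proof -
  have 1: "prelie scale B f (prepend (bas a) (bas u)) (bas v) =
     prepend (bas a) (prelie scale B f (bas u) (bas v)) +
     prepend (lmap scale B f (bas a)) (shuffle (bas u) (bas v))" for a u v
    by (simp add: prelie_bas shuffle_bas lmap_def)
  have 2: "prelie scale B f (prepend l (bas u)) (bas v) =
     prepend l (prelie scale B f (bas u) (bas v)) +
     prepend (lmap scale B f l) (shuffle (bas u) (bas v))" for u v
    by (rule lin_eqI[where p = l]) (intro lin_intros lin_lmap 1)+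
  have 3: "prelie scale B f (prepend l p) (bas v) =
     prepend l (prelie scale B f p (bas v)) +
     prepend (lmap scale B f l) (shuffle p (bas v))" for v
    by (rule lin_eqI[where p = p]) (intro lin_intros lin_lmap 2)+
  show ?thesis
    by (rule lin_eqI[where p = q]) (intro lin_intros lin_lmap 3)+
qed

lemma lookup_letter:
  assumes "vector_space scale"
  shows "Poly_Mapping.lookup (letter scale B x) b = module.representation scale B x b"
proof -
  interpret vector_space scale by fact
  show ?thesis
    using finite_representation[of B x]
    by (simp add: letter_def lookup_sum lookup_single when_def)
qed

lemma letter_basis:
  assumes "vector_space scale" "is_basis scale B" "b \<in> B"
  shows "letter scale B b = bas b"
proof -
  interpret vector_space scale by fact
  show ?thesis
    using assms
    by (intro poly_mapping_eqI)
       (simp add: lookup_letter is_basis_def representation_basis lookup_single when_def eq_commute)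
qed

lemma linear_letter:
  assumes "vector_space scale" "is_basis scale B"
  shows "Vector_Spaces.linear scale pscale (letter scale B)"
proof -
  interpret vector_space scale by fact
  show ?thesis
    unfolding Vector_Spaces.linear_iff using assms
    by (auto intro!: poly_mapping_eqI pm.vector_space_axioms
        simp: lookup_letter is_basis_def representation_add representation_scale lookup_add)
qed

lemma lmap_letter:
  assumes "vector_space scale" "is_basis scale B" "Vector_Spaces.linear scale scale f"
  shows "lmap scale B f (letter scale B x) = letter scale B (f x)"
proof -
  interpret V: vector_space scale by fact
  interpret vector_space_pair scale "pscale :: 'a \<Rightarrow> ('b \<Rightarrow>\<^sub>0 'a) \<Rightarrow> _"
    by (simp add: vector_space_pair_def assms pm.vector_space_axioms)
  have "Vector_Spaces.linear pscale pscale (lmap scale B f)"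
    using lin_lmap[OF lin_id] .
  then have 1: "Vector_Spaces.linear scale pscale (\<lambda>x. lmap scale B f (letter scale B x))"
    using Vector_Spaces.linear_compose[OF linear_letter[OF assms(1,2)]] by (fastforce simp: o_def)
  have 2: "Vector_Spaces.linear scale pscale (\<lambda>x. letter scale B (f x))"
    using Vector_Spaces.linear_compose[OF assms(3) linear_letter[OF assms(1,2)]] by (simp add: o_def)
  show ?thesis
  proof (rule linear_eq_on[OF 1 2])
    show "x \<in> V.span B" using assms(2) by (simp add: is_basis_def)
    show "lmap scale B f (letter scale B b) = letter scale B (f b)" if "b \<in> B" for b
      using that by (simp add: letter_basis[OF assms(1,2)] lmap_def)
  qed
qed

lemma prelie_letter:
  assumes "vector_space scale" "is_basis scale B" "Vector_Spaces.linear scale scale f"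
  shows "prelie scale B f (prepend (letter scale B x) p) q =
    prepend (letter scale B x) (prelie scale B f p q) +
    prepend (letter scale B (f x)) (shuffle p q)"
  by (simp add: prelie_prepend lmap_letter[OF assms])

lemma finite_decompositions: "finite (decompositions p k)"
proof (rule finite_subset)
  show "decompositions p k \<subseteq> {1..p} \<rightarrow>\<^sub>E Pow {1..k}" by (auto simp: decompositions_def)
qed (intro finite_PiE; simp)

lemma prelie_shuffle_step:
  fixes scale B f l m p q r
  defines "U \<equiv> prepend l p" and "V \<equiv> prepend m q" and "P \<equiv> prelie scale B f"
  shows "P (shuffle U V) r = prepend l (P (shuffle p V) r) +
      prepend (lmap scale B f l) (shuffle (shuffle p V) r) +
      (prepend m (P (shuffle U q) r) + prepend (lmap scale B f m) (shuffle (shuffle U q) r))"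
    and "shuffle (P U r) V + shuffle U (P V r) =
      prepend l (shuffle (P p r) V + shuffle p (P V r)) +
      prepend (lmap scale B f l) (shuffle (shuffle p r) V) +
      (prepend m (shuffle (P U r) q + shuffle U (P q r)) +
       prepend (lmap scale B f m) (shuffle U (shuffle q r)))"
  unfolding U_def V_def P_def
  by (simp_all add: shuffle_prepend shuffle_simps prepend_simps prelie_simps prelie_prepend add_ac)

lemma prelie_shuffle_words:
  fixes r :: "('v::ab_group_add, 'k::field) tens"
  shows "prelie scale B f (shuffle (bas u) (bas v)) r =
     shuffle (prelie scale B f (bas u) r) (bas v) + shuffle (bas u) (prelie scale B f (bas v) r)"
proof (induction "length u + length v" arbitrary: u v rule: less_induct)
  case less
  show ?case
  proof (cases "u = [] \<or> v = []")
    case False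
    then obtain a u' b v' where e: "u = a # u'" "v = b # v'"
      by (metis neq_Nil_conv)
    have 1: "prelie scale B f (shuffle (bas u') (bas v)) r =
      shuffle (prelie scale B f (bas u') r) (bas v) + shuffle (bas u') (prelie scale B f (bas v) r)"
      and 2: "prelie scale B f (shuffle (bas u) (bas v')) r =
      shuffle (prelie scale B f (bas u) r) (bas v') + shuffle (bas u) (prelie scale B f (bas v') r)"
      by (rule less; use e in simp)+
    have 3: "shuffle (shuffle (bas u') (bas v)) r = shuffle (shuffle (bas u') r) (bas v)"
      and 4: "shuffle (shuffle (bas u) (bas v')) r = shuffle (bas u) (shuffle (bas v') r)"
      by (rule shuffle_right_commute shuffle_assoc)+
    show ?thesis
      using prelie_shuffle_step[where scale = scale and B = B and f = f and l = "bas a" and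
          p = "bas u'" and m = "bas b" and q = "bas v'" and r = r]
      unfolding prepend_bas e[symmetric] 1 2 3 4 by (simp only:)
  qed (auto simp: shuffle_simps)
qed

lemma prelie_shuffle:
  "prelie scale B f (shuffle p q) r =
     shuffle (prelie scale B f p r) q + shuffle p (prelie scale B f q r)"
proof -
  have 1: "prelie scale B f (shuffle p (bas v)) r =
     shuffle (prelie scale B f p r) (bas v) + shuffle p (prelie scale B f (bas v) r)" for v
    by (rule lin_eqI[where p = p]) (intro lin_intros prelie_shuffle_words)+
  show ?thesis
    by (rule lin_eqI[where p = q]) (intro lin_intros 1)+
qed

section \<open>Sweedler sums\<close>

lemma iota_bas [simp]: "iota (bas a) = bas {#a#}"
  by (simp add: iota_def)

lemma bas_empty: "bas {#} = 1"
  by simp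

lemma bas_add_mset: "bas (add_mset a M) = iota (bas a) * bas M"
  by (simp add: mult_single)

lemma bas_mset: "bas (mset xs) = prod_list (map (\<lambda>a. iota (bas a)) xs)"
  by (induction xs) (simp_all add: bas_add_mset del: iota_bas)

lemma coproduct_one [simp]: "coproduct 1 = bas ({#}, {#})"
  unfolding bas_empty[symmetric] coproduct_def lin_ext_bas
  by (simp flip: zero_prod_def)

lemma sweedler_bas [simp]: "sweedler g (bas (M, N)) = g (bas M) (bas N)"
  by (simp add: sweedler_def)

lemma sweedler_one [simp]: "sweedler g (coproduct 1) = g 1 1"
  by simp

lemma sweedler_add:
  "sweedler (\<lambda>a b. g a b + h a b) Z = sweedler g Z + sweedler h Z"
  unfolding sweedler_def lin_ext_def by (simp add: pscale_add_right sum.distrib split_beta)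

lemma sweedler_diff:
  "sweedler (\<lambda>a b. g a b - h a b) Z = sweedler g Z - sweedler h Z"
  unfolding sweedler_def lin_ext_def by (simp add: pscale_diff_right sum_subtractf split_beta)

lemma sweedler_lin: "lin h \<Longrightarrow> h (sweedler g Z) = sweedler (\<lambda>a b. h (g a b)) Z"
  unfolding sweedler_def lin_ext_def by (simp add: lin_sum lin_scale split_beta)

lemma coproduct_mult_bas: "coproduct (bas {#u#} * bas M) =
    (bas ({#u#}, {#}) + bas ({#}, {#u#})) * coproduct (bas M)"
proof -
  have *: "bas {#u#} * bas M = bas (add_mset u M)" by (simp add: mult_single)
  show ?thesis unfolding * coproduct_def lin_ext_bas by simp
qed

lemma sweedler_gen:
  "sweedler g (coproduct (bas {#u#} * z)) =
   sweedler (\<lambda>a b. g (bas {#u#} * a) b + g a (bas {#u#} * b)) (coproduct z)"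
proof (rule lin_eqI[of "\<lambda>z. sweedler g (coproduct (bas {#u#} * z))"])
  have 1: "sweedler g (bas ({#u#}, {#}) * Z) = sweedler (\<lambda>a b. g (bas {#u#} * a) b) Z" for Z
  proof (rule lin_eqI[of "\<lambda>Z. sweedler g (bas ({#u#}, {#}) * Z)"])
    fix X show "sweedler g (bas ({#u#}, {#}) * bas X) =
        sweedler (\<lambda>a b. g (bas {#u#} * a) b) (bas X)"
      by (cases X) (simp add: mult_single)
  qed (intro lin_intros)+
  have 2: "sweedler g (bas ({#}, {#u#}) * Z) = sweedler (\<lambda>a b. g a (bas {#u#} * b)) Z" for Z
  proof (rule lin_eqI[of "\<lambda>Z. sweedler g (bas ({#}, {#u#}) * Z)"])
    fix X show "sweedler g (bas ({#}, {#u#}) * bas X) =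
        sweedler (\<lambda>a b. g a (bas {#u#} * b)) (bas X)"
      by (cases X) (simp add: mult_single)
  qed (intro lin_intros)+
  fix M
  have "sweedler g (A + C) = sweedler g A + sweedler g C" for A C
    by (intro lin_add lin_intros)
  then show "sweedler g (coproduct (bas {#u#} * bas M)) =
    sweedler (\<lambda>a b. g (bas {#u#} * a) b + g a (bas {#u#} * b)) (coproduct (bas M))"
    by (simp add: coproduct_mult_bas distrib_right 1 2 sweedler_add)
qed (intro lin_intros)+

lemma sweedler_iota:
  assumes "\<And>b. lin (\<lambda>a. g a b)" "\<And>a. lin (g a)"
  shows "sweedler g (coproduct (iota t * z)) =
    sweedler (\<lambda>a b. g (iota t * a) b + g a (iota t * b)) (coproduct z)"
proof (rule lin_eqI[of "\<lambda>t. sweedler g (coproduct (iota t * z))"])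
  have "lin (\<lambda>t. g (iota t * a) b)" "lin (\<lambda>t. g a (iota t * b))" for a b
    by (rule lin_comp[OF assms(1)] lin_comp[OF assms(2)], intro lin_intros)+
  then show "lin (\<lambda>t. sweedler (\<lambda>a b. g (iota t * a) b + g a (iota t * b)) (coproduct z))"
    by (intro lin_sweedler_fun lin_plus)
qed (intro lin_intros, simp add: sweedler_gen)

lemma sweedler_commute:
  "sweedler g (coproduct z) = sweedler (\<lambda>a b. g b a) (coproduct z)"
proof (rule lin_eqI[of "\<lambda>z. sweedler g (coproduct z)"])
  show "sweedler g (coproduct (bas M)) = sweedler (\<lambda>a b. g b a) (coproduct (bas M))" for M
  proof (induction M arbitrary: g)
    case (add u M)
    have *: "bas (add_mset u M) = bas {#u#} * bas M" by (simp add: mult_single)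
    show ?case unfolding * sweedler_gen
      by (subst add.IH) (simp add: add.commute)
  qed simp
qed (intro lin_intros)+

lemma sweedler_assoc:
  "sweedler (\<lambda>a b. sweedler (\<lambda>c d. h c d b) (coproduct a)) (coproduct z) =
   sweedler (\<lambda>a b. sweedler (\<lambda>c d. h a c d) (coproduct b)) (coproduct z)"
proof (rule lin_eqI[of "\<lambda>z. sweedler (\<lambda>a b. sweedler (\<lambda>c d. h c d b) (coproduct a)) (coproduct z)"])
  show "sweedler (\<lambda>a b. sweedler (\<lambda>c d. h c d b) (coproduct a)) (coproduct (bas M)) =
   sweedler (\<lambda>a b. sweedler (\<lambda>c d. h a c d) (coproduct b)) (coproduct (bas M))" for M
  proof (induction M arbitrary: h)
    case (add u M)
    have *: "bas (add_mset u M) = bas {#u#} * bas M" by (simp add: mult_single)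
    let ?u = "bas {#u#}"
    show ?case unfolding * sweedler_gen
      using add.IH[of "\<lambda>a b c. h (?u * a) b c + h a (?u * b) c + h a b (?u * c)"]
      by (simp add: sweedler_add add_ac)
  qed simp
qed (intro lin_intros)+

lemma coproduct_mult:
  fixes y z :: "('a, 'b::field) sym"
  shows "coproduct (y * z) = coproduct y * coproduct z"
proof -
  have 1: "coproduct (bas M * bas N) = coproduct (bas M) * (coproduct (bas N) :: ('a, 'b) sym2)" for M N
    unfolding coproduct_def mult_single by simp
  have 2: "coproduct (y * bas N) = coproduct y * coproduct (bas N)" for N
    by (rule lin_eqI[where p = y]) (intro lin_intros 1)+
  show ?thesis
    by (rule lin_eqI[where p = z]) (intro lin_intros 2)+
qed

lemma counit_one [simp]: "counit 1 = 1"
  by (simp add: counit_def)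

lemma counit_iota:
  fixes a :: "('a, 'k::field) sym"
  shows "counit (iota t * a) = 0"
proof -
  have 1: "pscale (counit (iota (bas u) * bas M)) (1 :: ('a, 'k) sym) = 0" for u M
    by (simp add: counit_def mult_single lookup_single)
  have 2: "pscale (counit (iota (bas u) * a)) (1 :: ('a, 'k) sym) = 0" for u
    by (rule lin_eqI[where p = a]) (intro lin_intros 1)+
  have "pscale (counit (iota t * a)) (1 :: ('a, 'k) sym) = 0"
    by (rule lin_eqI[where p = t]) (intro lin_intros 2)+
  then have "Poly_Mapping.lookup (pscale (counit (iota t * a)) (1 :: ('a, 'k) sym)) 0 = 0"
    by simp
  then show ?thesis by simp
qed

lemma counit_bas_mult [simp]: "counit (bas {#u#} * a) = 0"
  using counit_iota[of "bas u" a] by simp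

lemma sweedler_counit_left:
  assumes "lin h"
  shows "sweedler (\<lambda>a b. pscale (counit a) (h b)) (coproduct z) = h z"
proof (rule lin_eqI[OF _ assms])
  show "sweedler (\<lambda>a b. pscale (counit a) (h b)) (coproduct (bas M)) = h (bas M)" for M
  proof (induction M arbitrary: h)
    case (add u M)
    have *: "bas (add_mset u M) = bas {#u#} * bas M" by (simp add: mult_single)
    show ?case unfolding * sweedler_gen by (simp add: add.IH)
  qed simp
qed (intro lin_intros)

lemma sweedler_counit_right:
  assumes "lin h"
  shows "sweedler (\<lambda>a b. pscale (counit b) (h a)) (coproduct z) = h z"
  by (subst sweedler_commute) (rule sweedler_counit_left[OF assms])


section \<open>Existence of the extension\<close>

locale prelie_tensor =
  fixes scale :: "'k::field \<Rightarrow> 'v::ab_group_add \<Rightarrow> 'v" and B :: "'v set" and f :: "'v \<Rightarrow> 'v"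
begin

abbreviation "pl \<equiv> prelie scale B f"
abbreviation "phi \<equiv> lmap scale B f"

definition der :: "('v, 'k) tens \<Rightarrow> ('v list, 'k) sym \<Rightarrow> ('v list, 'k) sym" where
  "der c = lin_ext (\<lambda>M. \<Sum>u\<in>#M. iota (pl (bas u) c) * bas (M - {#u#}))"

lemma lin_sum_mset: "(\<And>u. lin (g u)) \<Longrightarrow> lin (\<lambda>x. \<Sum>u\<in>#M. g u x)"
  by (induction M) (auto intro!: lin_intros)

lemma lin_der: "lin h \<Longrightarrow> lin (\<lambda>x. der c (h x))" "lin h' \<Longrightarrow> lin (\<lambda>x. der (h' x) z)"
  unfolding der_def by (intro lin_intros lin_lin_ext_fun lin_sum_mset; assumption)+

lemma der_one [simp]: "der c 1 = 0"
  unfolding der_def bas_empty[symmetric] lin_ext_bas by simp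

lemma der_iota: "der c (iota t * z) = iota (pl t c) * z + iota t * der c z"
proof -
  have 1: "der c (iota (bas u) * bas M) = iota (pl (bas u) c) * bas M + iota (bas u) * der c (bas M)"
    for u M
  proof -
    have *: "iota (bas u) * bas M = bas (add_mset u M)" by (simp add: mult_single)
    have "bas (add_mset u M - {#v#}) = (bas {#u#} * bas (M - {#v#}) :: ('v list, 'k) sym)"
      if "v \<in># M" for v
      using that by (simp add: mult_single)
    then have "(\<Sum>v\<in>#M. iota (pl (bas v) c) * bas (add_mset u M - {#v#})) =
        (\<Sum>v\<in>#M. iota (bas u) * (iota (pl (bas v) c) * bas (M - {#v#})))"
      by (intro arg_cong[of _ _ sum_mset] image_mset_cong)
         (simp add: mult.left_commute del: add_mset_diff_bothsides diff_union_swap2)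
    then show ?thesis
      unfolding * unfolding der_def lin_ext_bas
      by (simp add: sum_mset_distrib_left image_mset.compositionality o_def)
  qed
  have 2: "der c (iota (bas u) * z) = iota (pl (bas u) c) * z + iota (bas u) * der c z" for u
    by (rule lin_eqI[where p = z]) (intro lin_intros lin_der 1)+
  show ?thesis
    by (rule lin_eqI[where p = t]) (intro lin_intros lin_der 2)+
qed

definition shuffle_mset :: "('v, 'k) tens \<Rightarrow> 'v list multiset \<Rightarrow> ('v, 'k) tens" where
  "shuffle_mset t M = fold_mset (\<lambda>u t. shuffle t (bas u)) t M"

lemma shuffle_mset_simps [simp]:
  "shuffle_mset t {#} = t"
  "shuffle_mset t (add_mset u M) = shuffle_mset (shuffle t (bas u)) M"
proof -
  interpret comp_fun_commute "\<lambda>u t. shuffle t (bas u) :: ('v, 'k) tens"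
    by unfold_locales (simp add: fun_eq_iff shuffle_right_commute)
  show "shuffle_mset t {#} = t"
    "shuffle_mset t (add_mset u M) = shuffle_mset (shuffle t (bas u)) M"
    by (simp_all add: shuffle_mset_def fold_mset_fun_left_comm)
qed

lemma lin_shuffle_mset: "lin h \<Longrightarrow> lin (\<lambda>x. shuffle_mset (h x) M)"
  by (induction M arbitrary: h) (auto intro: lin_shuffle)

definition graft :: "('v \<Rightarrow>\<^sub>0 'k) \<Rightarrow> ('v list, 'k) sym \<Rightarrow> ('v, 'k) tens \<Rightarrow> ('v, 'k) tens" where
  "graft l a t = lin_ext (\<lambda>M. prepend ((phi ^^ size M) l) (shuffle_mset t M)) a"

lemma lin_graft:
  "lin h1 \<Longrightarrow> lin (\<lambda>x. graft (h1 x) a t)"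
  "lin h2 \<Longrightarrow> lin (\<lambda>x. graft l (h2 x) t)"
  "lin h3 \<Longrightarrow> lin (\<lambda>x. graft l a (h3 x))"
  unfolding graft_def
  by (intro lin_intros lin_lin_ext_fun lin_lmap_funpow lin_shuffle_mset; assumption)+

lemma graft_one [simp]: "graft l 1 t = prepend l t"
  unfolding graft_def bas_empty[symmetric] lin_ext_bas by simp

lemma graft_iota: "graft l (iota c * a) t = graft (phi l) a (shuffle t c)"
proof -
  have 1: "graft l (iota (bas u) * bas M) t = graft (phi l) (bas M) (shuffle t (bas u))" for u M
  proof -
    have *: "iota (bas u) * bas M = bas (add_mset u M)" by (simp add: mult_single)
    show ?thesis
      unfolding * unfolding graft_def lin_ext_bas by (simp add: funpow_swap1)
  qed
  have 2: "graft l (iota (bas u) * a) t = graft (phi l) a (shuffle t (bas u))" for u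
    by (rule lin_eqI[where p = a]) (intro lin_intros lin_graft 1)+
  show ?thesis
    by (rule lin_eqI[where p = c]) (intro lin_intros lin_graft 2)+
qed

lemma graft_simps:
  "graft l (a + a') t = graft l a t + graft l a' t"
  "graft l a (t + t') = graft l a t + graft l a t'"
  "graft l a (t - t') = graft l a t - graft l a t'"
  "graft l 0 t = 0"
  by (rule lin_add lin_diff lin_0, intro lin_intros lin_graft)+

lemma prelie_graft:
  "pl (graft l a t) c = graft l a (pl t c) + graft l (der c a) t + graft (phi l) a (shuffle t c)"
proof (rule lin_eqI[of "\<lambda>a. pl (graft l a t) c"])
  show "pl (graft l (bas M) t) c =
    graft l (bas M) (pl t c) + graft l (der c (bas M)) t + graft (phi l) (bas M) (shuffle t c)" for M
  proof (induction M arbitrary: l t)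
    case empty
    show ?case by (simp add: prelie_prepend graft_simps)
  next
    case (add u M)
    show ?case
      unfolding bas_add_mset graft_iota der_iota graft_simps add.IH prelie_shuffle
        shuffle_right_commute[of t "bas u" c]
      by (simp add: add_ac)
  qed
qed (intro lin_intros lin_graft lin_der)+

primrec word_bullet :: "'v list \<Rightarrow> ('v list, 'k) sym \<Rightarrow> ('v, 'k) tens" where
  "word_bullet [] = (\<lambda>z. pscale (counit z) (bas []))"
| "word_bullet (x # w) =
    (\<lambda>z. sweedler (\<lambda>a b. graft (bas x) a (word_bullet w b)) (coproduct z))"

lemma lin_word_bullet: "lin h \<Longrightarrow> lin (\<lambda>x. word_bullet w (h x))"
  by (cases w) (simp_all only: word_bullet.simps, (intro lin_intros; assumption)+)

lemma word_bullet_one [simp]: "word_bullet w 1 = bas w"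
  by (induction w) auto

lemma sweedler_der:
  assumes "\<And>b. lin (\<lambda>a. g a b)" "\<And>a. lin (g a)"
  shows "sweedler g (coproduct (der c z)) =
    sweedler (\<lambda>a b. g (der c a) b + g a (der c b)) (coproduct z)"
proof (rule lin_eqI[of "\<lambda>z. sweedler g (coproduct (der c z))"])
  show "sweedler g (coproduct (der c (bas M))) =
    sweedler (\<lambda>a b. g (der c a) b + g a (der c b)) (coproduct (bas M))" for M
    using assms
  proof (induction M arbitrary: g)
    case empty
    then show ?case
      by (simp add: lin_0[OF empty(2)] lin_0[OF empty(1)] lin_0[where h = "\<lambda>z. sweedler g (coproduct z)"] lin_intros)
  next
    case (add u M)
    note l = lin_comp[OF add.prems(1)] lin_comp[OF add.prems(2)]
    note a = lin_add[OF add.prems(1)] lin_add[OF add.prems(2)]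
    have s: "sweedler g (coproduct (p + q)) =
      sweedler g (coproduct p) + sweedler g (coproduct q)" for p q
      by (rule lin_add[where h = "\<lambda>z. sweedler g (coproduct z)"]) (intro lin_intros)
    let ?u = "iota (bas u) :: ('v list, 'k) sym" and ?v = "iota (pl (bas u) c)"
    have 1: "sweedler g (coproduct (?v * bas M)) =
        sweedler (\<lambda>a b. g (?v * a) b + g a (?v * b)) (coproduct (bas M))"
      by (rule sweedler_iota[OF add.prems])
    have 2: "sweedler g (coproduct (?u * der c (bas M))) =
        sweedler (\<lambda>a b. g (?u * a) b + g a (?u * b)) (coproduct (der c (bas M)))"
      by (rule sweedler_iota[OF add.prems])
    have 3: "\<dots> = sweedler (\<lambda>a b. (g (?u * der c a) b + g (der c a) (?u * b)) +
        (g (?u * a) (der c b) + g a (?u * der c b))) (coproduct (bas M))"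
      by (rule add.IH; intro lin_plus l lin_intros)
    have 4: "sweedler (\<lambda>a b. g (der c a) b + g a (der c b)) (coproduct (?u * bas M)) =
        sweedler (\<lambda>a b. (g (der c (?u * a)) b + g (?u * a) (der c b)) +
          (g (der c a) (?u * b) + g a (der c (?u * b)))) (coproduct (bas M))"
      by (rule sweedler_iota; intro lin_plus l lin_der lin_intros add.prems)
    show ?case
      unfolding bas_add_mset der_iota s 1 2 3 4
      by (simp add: a sweedler_add add_ac del: iota_bas)
  qed
qed (intro lin_intros lin_der)+

lemma counit_der: "counit (der c z) = 0"
proof -
  have 1: "pscale (counit (der c (bas M))) (1 :: ('v list, 'k) sym) = 0" for M
  proof (cases M)
    case (add u N)
    have "counit (p + q) = counit p + counit q" for p q :: "('v list, 'k) sym"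
      by (simp add: counit_def lookup_add)
    then show ?thesis
      unfolding add bas_add_mset der_iota by (simp add: counit_iota del: iota_bas)
  qed (simp add: counit_def)
  have "pscale (counit (der c z)) (1 :: ('v list, 'k) sym) = 0"
    by (rule lin_eqI[of "\<lambda>z. pscale (counit (der c z)) 1" "\<lambda>_. 0"]) (intro lin_intros lin_der 1)+
  then have "Poly_Mapping.lookup (pscale (counit (der c z)) (1 :: ('v list, 'k) sym)) 0 = 0"
    by simp
  then show ?thesis by simp
qed

lemma word_bullet_iota:
  "word_bullet w (iota c * z) = pl (word_bullet w z) c - word_bullet w (der c z)"
proof (induction w arbitrary: z)
  case Nil
  have "pl (pscale (counit z) (bas [])) c = pscale (counit z) (pl (bas []) c)"
    by (rule lin_scale[where h = "\<lambda>t. pl t c"]) (intro lin_intros)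
  then show ?case by (simp add: counit_iota counit_der)
next
  case (Cons x w)
  let ?g = "\<lambda>a b. graft (bas x) a (word_bullet w b)"
  have l: "lin (\<lambda>a. ?g a b)" "lin (?g a)" for a b
    by (intro lin_graft lin_word_bullet lin_intros)+
  let ?S = "\<lambda>g. sweedler g (coproduct z)"
  let ?w = "\<lambda>b. word_bullet w b"
  let ?A = "?S (\<lambda>a b. graft (phi (bas x)) a (shuffle (?w b) c))"
  let ?B = "?S (\<lambda>a b. graft (bas x) a (pl (?w b) c))"
  let ?C = "?S (\<lambda>a b. graft (bas x) (der c a) (?w b))"
  let ?D = "?S (\<lambda>a b. graft (bas x) a (?w (der c b)))"
  have "sweedler ?g (coproduct (iota c * z)) = ?A + (?B - ?D)"
    unfolding sweedler_iota[of ?g, OF l] graft_iota Cons.IH graft_simps sweedler_add sweedler_diff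
    by (rule refl)
  moreover have "sweedler ?g (coproduct (der c z)) = ?C + ?D"
    unfolding sweedler_der[of ?g, OF l] sweedler_add by (rule refl)
  moreover have "pl (?S ?g) c = ?B + ?C + ?A"
    unfolding sweedler_lin[where h = "\<lambda>t. pl t c", OF lin_prelie(1)[OF lin_id]] prelie_graft
      sweedler_add by (rule refl)
  ultimately show ?case
    by (simp only: word_bullet.simps) (simp add: algebra_simps)
qed

definition tens_bullet :: "('v, 'k) tens \<Rightarrow> ('v list, 'k) sym \<Rightarrow> ('v, 'k) tens" where
  "tens_bullet t z = lin_ext (\<lambda>w. word_bullet w z) t"

lemma lin_tens_bullet:
  "lin h \<Longrightarrow> lin (\<lambda>x. tens_bullet (h x) z)" "lin h' \<Longrightarrow> lin (\<lambda>x. tens_bullet t (h' x))"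
  unfolding tens_bullet_def by (intro lin_intros lin_lin_ext_fun lin_word_bullet; assumption)+

lemma tens_bullet_one [simp]: "tens_bullet t 1 = t"
  by (rule lin_eqI[where p = t]) ((intro lin_intros lin_tens_bullet)+, simp add: tens_bullet_def)

lemma tens_bullet_iota:
  "tens_bullet t (iota c * z) = pl (tens_bullet t z) c - tens_bullet t (der c z)"
  by (rule lin_eqI[where p = t])
     ((intro lin_intros lin_tens_bullet)+, simp add: tens_bullet_def word_bullet_iota)

definition conv :: "'v list \<Rightarrow> (('v list, 'k) sym \<Rightarrow> ('v list, 'k) sym) \<Rightarrow>
    ('v list, 'k) sym \<Rightarrow> ('v list, 'k) sym" where
  "conv u h z = sweedler (\<lambda>a b. iota (word_bullet u a) * h b) (coproduct z)"

lemma conv_commute: "conv u (conv v h) z = conv v (conv u h) z"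
proof -
  have push: "q * sweedler g Z = sweedler (\<lambda>a b. q * g a b) Z"
    for q :: "('v list, 'k) sym" and g and Z :: "('v list, 'k) sym2"
    by (rule sweedler_lin) (intro lin_intros)
  have e: "conv u (conv v h) z =
    sweedler (\<lambda>a b. sweedler (\<lambda>c d. iota (word_bullet u c) * iota (word_bullet v d) * h b)
      (coproduct a)) (coproduct z)" for u v
    unfolding conv_def push mult.assoc[symmetric]
    by (rule sweedler_assoc[symmetric])
  show ?thesis
    unfolding e[of u v] e[of v u]
    by (subst sweedler_commute) (simp add: mult.commute)
qed

definition ext_mset :: "'v list multiset \<Rightarrow> ('v list, 'k) sym \<Rightarrow> ('v list, 'k) sym" where
  "ext_mset M = fold_mset conv (\<lambda>z. pscale (counit z) 1) M"

lemma ext_mset_simps: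
  "ext_mset {#} = (\<lambda>z. pscale (counit z) 1)"
  "ext_mset (add_mset u M) = conv u (ext_mset M)"
proof -
  interpret comp_fun_commute conv
    by unfold_locales (simp add: fun_eq_iff conv_commute)
  show "ext_mset {#} = (\<lambda>z. pscale (counit z) 1)" "ext_mset (add_mset u M) = conv u (ext_mset M)"
    by (simp_all add: ext_mset_def)
qed

lemma lin_ext_mset: "lin (ext_mset M)"
  by (cases M) (auto simp: ext_mset_simps conv_def[abs_def] intro!: lin_intros)

definition ext :: "('v list, 'k) sym \<Rightarrow> ('v list, 'k) sym \<Rightarrow> ('v list, 'k) sym" where
  "ext y z = lin_ext (\<lambda>M. ext_mset M z) y"

lemma lin_ext': "lin h \<Longrightarrow> lin (\<lambda>x. ext (h x) z)" "lin h' \<Longrightarrow> lin (\<lambda>x. ext y (h' x))"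
proof -
  show "lin h' \<Longrightarrow> lin (\<lambda>x. ext y (h' x))"
    unfolding ext_def by (intro lin_lin_ext_fun) (rule lin_comp[OF lin_ext_mset])
  show "lin h \<Longrightarrow> lin (\<lambda>x. ext (h x) z)"
    unfolding ext_def by (intro lin_intros)
qed

lemma ext_one_left: "ext 1 z = pscale (counit z) 1"
  unfolding ext_def bas_empty[symmetric] lin_ext_bas by (simp add: ext_mset_simps)

lemma ext_iota_mult:
  "ext (iota t * y) z = sweedler (\<lambda>a b. iota (tens_bullet t a) * ext y b) (coproduct z)"
proof -
  have 1: "ext (iota (bas u) * bas M) z =
      sweedler (\<lambda>a b. iota (tens_bullet (bas u) a) * ext (bas M) b) (coproduct z)" for u M
  proof -
    have *: "iota (bas u) * bas M = bas (add_mset u M)" by (simp add: mult_single)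
    show ?thesis
      unfolding * unfolding ext_def lin_ext_bas tens_bullet_def
      by (simp add: ext_mset_simps conv_def)
  qed
  have 2: "ext (iota (bas u) * y) z =
      sweedler (\<lambda>a b. iota (tens_bullet (bas u) a) * ext y b) (coproduct z)" for u
    by (rule lin_eqI[where p = y]) (intro lin_intros lin_ext' 1)+
  show ?thesis
    by (rule lin_eqI[where p = t]) (intro lin_intros lin_ext' lin_tens_bullet 2)+
qed

lemma ext_iota: "ext (iota t) z = iota (tens_bullet t z)"
  using ext_iota_mult[of t 1 z]
  by (simp add: ext_one_left pscale_mult sweedler_counit_right lin_tens_bullet lin_intros)

lemma ext_one_right: "ext y 1 = y"
proof (rule lin_eqI[of "\<lambda>y. ext y 1" "\<lambda>y. y"])
  show "ext (bas M) 1 = bas M" for M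
    by (induction M) (simp_all only: bas_empty bas_add_mset ext_iota_mult, simp_all add: ext_one_left)
qed (intro lin_intros lin_ext')+

lemma ext_iota_right: "ext y (iota c) = der c y"
proof (rule lin_eqI[of "\<lambda>y. ext y (iota c)"])
  show "ext (bas M) (iota c) = der c (bas M)" for M
  proof (induction M)
    case empty
    show ?case using counit_iota[of c 1] by (simp add: ext_one_left)
  next
    case (add u M)
    have "ext (iota (bas u) * bas M) (iota c) =
      sweedler (\<lambda>a b. iota (tens_bullet (bas u) a) * ext (bas M) b) (coproduct (iota c * 1))"
      by (simp add: ext_iota_mult del: iota_bas)
    also have "\<dots> = iota (tens_bullet (bas u) (iota c * 1)) * ext (bas M) 1 +
        iota (tens_bullet (bas u) 1) * ext (bas M) (iota c * 1)"
      by (subst sweedler_iota) ((intro lin_intros lin_tens_bullet lin_ext')+, simp)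
    also have "\<dots> = der c (iota (bas u) * bas M)"
      unfolding tens_bullet_iota der_iota
      by (simp add: add.IH ext_one_right lin_0[OF lin_tens_bullet(2)[OF lin_id]] del: iota_bas)
    finally show ?case unfolding bas_add_mset .
  qed
qed (intro lin_intros lin_ext' lin_der)+

lemma ext_mult: "ext (y * y') z = sweedler (\<lambda>a b. ext y a * ext y' b) (coproduct z)"
proof (rule lin_eqI[of "\<lambda>y. ext (y * y') z"])
  show "ext (bas M * y') z = sweedler (\<lambda>a b. ext (bas M) a * ext y' b) (coproduct z)" for M
  proof (induction M arbitrary: z)
    case empty
    show ?case
      by (simp add: ext_one_left pscale_mult sweedler_counit_left lin_ext' lin_intros)
  next
    case (add u M)
    have push: "q * sweedler g Z = sweedler (\<lambda>a b. q * g a b) Z"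
         "sweedler g Z * q = sweedler (\<lambda>a b. g a b * q) Z"
      for q :: "('v list, 'k) sym" and g and Z :: "('v list, 'k) sym2"
      by (rule sweedler_lin, intro lin_intros)+
    show ?case
      unfolding bas_add_mset mult.assoc ext_iota_mult add.IH push
      by (simp add: sweedler_assoc[where h = "\<lambda>a b c. iota (tens_bullet (bas u) a) * (ext (bas M) b * ext y' c)"] del: iota_bas)
  qed
qed (intro lin_intros lin_ext')+

lemma oudom_guin_extension_ext: "oudom_guin_extension pl ext"
proof -
  have tb0: "tens_bullet t 0 = 0" for t
    by (rule lin_0[OF lin_tens_bullet(2)[OF lin_id]])
  have "ext (iota u) (iota v) = iota (pl u v)" for u v
    using tens_bullet_iota[of u v 1] by (simp add: ext_iota tb0)
  moreover have "ext (iota u) (z * iota v) =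
      ext (ext (iota u) z) (iota v) - ext (iota u) (ext z (iota v))" for u v z
  proof -
    have "ext (iota (tens_bullet u z)) (iota v) = iota (pl (tens_bullet u z) v)"
      using tens_bullet_iota[of "tens_bullet u z" v 1] by (simp add: ext_iota tb0)
    moreover have "iota (p - q) = iota p - iota q" for p q :: "('v, 'k) tens"
      by (rule lin_diff) (intro lin_intros)
    ultimately show ?thesis
      by (simp add: ext_iota ext_iota_right tens_bullet_iota mult.commute[of z])
  qed
  ultimately show ?thesis
    unfolding oudom_guin_extension_def
    by (auto simp: ext_one_left ext_one_right ext_mult lin_ext' lin_id)
qed

end


section \<open>Uniqueness of the extension\<close>

lemma oudom_guin_extension_iota:
  assumes b: "oudom_guin_extension p bul"
  shows "bul (iota u * y) (iota v) = iota (p u v) * y + iota u * bul y (iota v)"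
proof -
  have l: "lin (bul y)" "lin (\<lambda>y. bul y z)" for y z
    using b by (auto simp: oudom_guin_extension_def)
  have "bul (iota u * y) (iota v) =
      sweedler (\<lambda>a c. bul (iota u) a * bul y c) (coproduct (iota v * 1))"
    using b by (simp add: oudom_guin_extension_def)
  also have "\<dots> = bul (iota u) (iota v) * bul y 1 + bul (iota u) 1 * bul y (iota v)"
    by (subst sweedler_iota) ((intro lin_times l)+, simp)
  finally show ?thesis
    using b by (simp add: oudom_guin_extension_def)
qed

lemma oudom_guin_extension_eqI:
  assumes b: "oudom_guin_extension p bul" and "lin h" "lin g"
    and "\<And>us'. length us' = length us \<Longrightarrow>
      h (prod_list (map iota us')) = g (prod_list (map iota us'))"
  shows "h (bul (prod_list (map iota us)) (iota v)) = g (bul (prod_list (map iota us)) (iota v))"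
  using assms(2-)
proof (induction us arbitrary: h g)
  case Nil
  have "counit (iota v) = 0" using counit_iota[of v 1] by simp
  then have "bul 1 (iota v) = 0" using b by (simp add: oudom_guin_extension_def)
  then show ?case using Nil by (simp add: lin_0)
next
  case (Cons u us)
  have "h (iota (p u v) * prod_list (map iota us)) = g (iota (p u v) * prod_list (map iota us))"
    using Cons.prems(3)[of "p u v # us"] by simp
  moreover have "h (iota u * bul (prod_list (map iota us)) (iota v)) =
      g (iota u * bul (prod_list (map iota us)) (iota v))"
  proof (rule Cons.IH)
    show "lin (\<lambda>x. h (iota u * x))" "lin (\<lambda>x. g (iota u * x))"
      by (rule lin_comp[OF Cons.prems(1)] lin_comp[OF Cons.prems(2)], intro lin_intros)+
    show "h (iota u * prod_list (map iota us')) = g (iota u * prod_list (map iota us'))"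
      if "length us' = length us" for us'
      using Cons.prems(3)[of "u # us'"] that by simp
  qed
  ultimately show ?case
    by (simp add: oudom_guin_extension_iota[OF b] lin_add[OF Cons.prems(1)] lin_add[OF Cons.prems(2)])
qed

lemma oudom_guin_extension_unique:
  assumes b: "oudom_guin_extension p bul" and b': "oudom_guin_extension p bul'"
  shows "bul = bul'"
proof -
  have l: "lin (bul y)" "lin (\<lambda>y. bul y z)" "lin (bul' y)" "lin (\<lambda>y. bul' y z)" for y z
    using b b' by (auto simp: oudom_guin_extension_def)
  have right: "bul y (iota v) = bul' y (iota v)" for y v
  proof (rule lin_eqI[OF l(2) l(4)])
    show "bul (bas M) (iota v) = bul' (bas M) (iota v)" for M
    proof (induction M)
      case empty
      then show ?case using b b' by (simp add: oudom_guin_extension_def)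
    next
      case (add u M)
      then show ?case
        unfolding bas_add_mset oudom_guin_extension_iota[OF b] oudom_guin_extension_iota[OF b']
        by simp
    qed
  qed
  have lists: "bul (iota t) (prod_list (map iota us)) = bul' (iota t) (prod_list (map iota us))"
    if "length us = n" for t us n
    using that
  proof (induction n arbitrary: t us)
    case 0
    then show ?case using b b' by (simp add: oudom_guin_extension_def)
  next
    case (Suc n)
    then obtain us' v where us: "us = us' @ [v]" "length us' = n"
      by (metis length_Suc_conv_rev)
    have "bul (iota t) (bul (prod_list (map iota us')) (iota v)) =
        bul' (iota t) (bul (prod_list (map iota us')) (iota v))"
      by (rule oudom_guin_extension_eqI[OF b l(1) l(3)]) (use us Suc.IH in auto)
    moreover have *: "c (iota t) (prod_list (map iota us') * iota v) =
        c (c (iota t) (prod_list (map iota us'))) (iota v) -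
        c (iota t) (c (prod_list (map iota us')) (iota v))" if "oudom_guin_extension p c" for c
      using that by (simp add: oudom_guin_extension_def)
    ultimately show ?case
      using *[OF b] *[OF b'] Suc.IH[OF us(2)] by (simp add: us right)
  qed
  have left: "bul (iota t) z = bul' (iota t) z" for t z
  proof (rule lin_eqI[OF l(1) l(3)])
    fix M :: "'a multiset"
    obtain xs where "M = mset xs" by (metis ex_mset)
    then have "bas M = prod_list (map iota (map bas xs))"
      by (simp add: bas_mset o_def del: iota_bas)
    then show "bul (iota t) (bas M) = bul' (iota t) (bas M)"
      using lists by metis
  qed
  have "bul y z = bul' y z" for y z
  proof (rule lin_eqI[OF l(2) l(4)])
    show "bul (bas M) z = bul' (bas M) z" for M
    proof (induction M arbitrary: z)
      case empty
      then show ?case using b b' by (simp add: oudom_guin_extension_def)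
    next
      case (add u M)
      have *: "c (iota (bas u) * bas M) z =
        sweedler (\<lambda>z1 z2. c (iota (bas u)) z1 * c (bas M) z2) (coproduct z)"
        if "oudom_guin_extension p c" for c
        using that by (simp add: oudom_guin_extension_def del: iota_bas)
      then show ?case
        using *[OF b] *[OF b'] by (simp only: bas_add_mset left add.IH)
    qed
  qed
  then show ?thesis by blast
qed

lemma ex1_oudom_guin_extension: "\<exists>!bul. oudom_guin_extension (prelie scale B f) bul"
  using prelie_tensor.oudom_guin_extension_ext[of scale B f] oudom_guin_extension_unique by blast

lemma oudom_guin_extension_bullet:
  "oudom_guin_extension (prelie scale B f) (bullet (prelie scale B f))"
  unfolding bullet_def by (rule theI'[OF ex1_oudom_guin_extension])

end

theory Submission
  imports Defs
begin

text \<open>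
  The Oudom-Guin extension is unique, so it may be computed with any model. In the model
  \<open>prelie_tensor.ext\<close> the bullet of a word \<open>x v\<close> with an element \<open>z\<close> obeys the recursion
  \<open>(x v) \<bullet> z = graft x z\<^sup>(\<^sup>1\<^sup>) (v \<bullet> z\<^sup>(\<^sup>2\<^sup>))\<close>: one tensor factor of the coproduct acts on the first
  letter, the other one on the remaining word. For a product \<open>w\<^sub>1 \<times> \<dots> \<times> w\<^sub>k\<close> of
  primitive elements the coproduct is the sum over all ways to split the index set into a subset
  and its complement (\<open>sweedler_prod_iota\<close>), and grafting \<open>w\<^sub>J\<close> onto a letter \<open>x\<close> applies \<open>f\<close> to \<open>x\<close>
  once per element of \<open>J\<close> and shuffles all of these words into what follows (\<open>graft_prod_iota\<close>).

  The recursion thus reads: choose the set of indices going to the first letter and distribute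
  the others over the remaining letters. Ordered decompositions of a set satisfy the same
  recursion (\<open>sum_ordered_decompositions_insert\<close>), and the empty word, which is killed by everything
  of positive degree, forces all indices to be used up at the end. An induction on the letters
  from the last to the first gives the formula for the bullet. The formula for the star product
  is one further splitting, in which the block that is split off is left untouched as a factor of
  the symmetric algebra.
\<close>

section \<open>Decompositions of a set indexed by an arbitrary set\<close>

text \<open>
  Arbitrary index sets allow blocks to be split off at either end: the bullet splits off
  the block of the first letter, the star product the last block.
\<close>

definition ordered_decompositions :: "'p set \<Rightarrow> 'a set \<Rightarrow> ('p \<Rightarrow> 'a set) set" where
  "ordered_decompositions P A =
    {I \<in> P \<rightarrow>\<^sub>E Pow A. disjoint_family_on I P \<and> (\<Union>p\<in>P. I p) = A}"

lemma decompositions_eq: "decompositions p k = ordered_decompositions {1..p} {1..k}"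
  by (simp add: decompositions_def ordered_decompositions_def)

lemma finite_ordered_decompositions:
  assumes "finite P" "finite A"
  shows "finite (ordered_decompositions P A)"
proof (rule finite_subset)
  show "ordered_decompositions P A \<subseteq> P \<rightarrow>\<^sub>E Pow A" by (auto simp: ordered_decompositions_def)
qed (use assms in \<open>auto intro: finite_PiE\<close>)

lemma ordered_decompositions_empty:
  "ordered_decompositions {} A = (if A = {} then {\<lambda>_. undefined} else {})"
  by (auto simp: ordered_decompositions_def disjoint_family_on_def)

lemma ordered_decompositions_upd:
  assumes "p \<notin> P" "J \<subseteq> A" "I \<in> ordered_decompositions P (A - J)"
  shows "I(p := J) \<in> ordered_decompositions (insert p P) A"
proof -
  have I: "I \<in> P \<rightarrow>\<^sub>E Pow (A - J)" "disjoint_family_on I P" "(\<Union>q\<in>P. I q) = A - J"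
    using assms(3) by (auto simp: ordered_decompositions_def)
  have "I(p := J) \<in> insert p P \<rightarrow>\<^sub>E Pow A"
  proof (rule PiE_I)
    fix q assume "q \<in> insert p P"
    then show "(I(p := J)) q \<in> Pow A"
      using PiE_mem[OF I(1)] assms(2) by (cases "q = p") auto
  next
    fix q assume "q \<notin> insert p P"
    then show "(I(p := J)) q = undefined" using PiE_arb[OF I(1)] by auto
  qed
  moreover have "disjoint_family_on (I(p := J)) (insert p P)"
    unfolding disjoint_family_on_def
  proof (intro ballI impI)
    fix q r assume qr: "q \<in> insert p P" "r \<in> insert p P" "q \<noteq> r"
    have "I s \<inter> J = {}" if "s \<in> P" for s using PiE_mem[OF I(1) that] by auto
    moreover have "I q \<inter> I r = {}" if "q \<in> P" "r \<in> P"
      using that qr(3) I(2) by (auto simp: disjoint_family_on_def)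
    ultimately show "(I(p := J)) q \<inter> (I(p := J)) r = {}"
      using qr by (cases "q = p"; cases "r = p") auto
  qed
  moreover have "(\<Union>q\<in>insert p P. (I(p := J)) q) = J \<union> (\<Union>q\<in>P. I q)"
    using assms(1) by auto
  moreover have "\<dots> = A" using I(3) assms(2) by auto
  ultimately show ?thesis
    unfolding ordered_decompositions_def by (simp only: mem_Collect_eq simp_thms)
qed

lemma ordered_decompositions_remove:
  assumes "p \<notin> P" "I \<in> ordered_decompositions (insert p P) A"
  shows "I p \<subseteq> A" "I(p := undefined) \<in> ordered_decompositions P (A - I p)"
proof -
  have I: "I \<in> insert p P \<rightarrow>\<^sub>E Pow A" "disjoint_family_on I (insert p P)"
      "(\<Union>q\<in>insert p P. I q) = A"
    using assms(2) by (auto simp: ordered_decompositions_def)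
  show "I p \<subseteq> A" using I(3) by auto
  have d: "I q \<inter> I p = {}" if "q \<in> P" for q
    using I(2) that assms(1) by (auto simp: disjoint_family_on_def)
  have "I(p := undefined) \<in> P \<rightarrow>\<^sub>E Pow (A - I p)"
  proof (rule PiE_I)
    fix q assume "q \<in> P"
    then show "(I(p := undefined)) q \<in> Pow (A - I p)"
      using I(3) d[of q] assms(1) by auto
  next
    fix q assume "q \<notin> P"
    then show "(I(p := undefined)) q = undefined" using PiE_arb[OF I(1)] by auto
  qed
  moreover have "disjoint_family_on (I(p := undefined)) P"
    using I(2) assms(1) by (auto simp: disjoint_family_on_def)
  moreover have "(\<Union>q\<in>P. (I(p := undefined)) q) = (\<Union>q\<in>P. I q)"
    using assms(1) by auto
  moreover have "\<dots> = A - I p" using I(3) d by auto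
  ultimately show "I(p := undefined) \<in> ordered_decompositions P (A - I p)"
    by (simp add: ordered_decompositions_def)
qed

lemma sum_ordered_decompositions_insert:
  assumes "finite P" "finite A" "p \<notin> P"
  shows "(\<Sum>I\<in>ordered_decompositions (insert p P) A. F I) =
    (\<Sum>J\<in>Pow A. \<Sum>I\<in>ordered_decompositions P (A - J). F (I(p := J)))"
proof -
  let ?S = "Sigma (Pow A) (\<lambda>J. ordered_decompositions P (A - J))"
  have "(\<Sum>I\<in>ordered_decompositions (insert p P) A. F I) = (\<Sum>(J, I)\<in>?S. F (I(p := J)))"
  proof (rule sum.reindex_bij_witness[where i = "\<lambda>(J, I). I(p := J)"
        and j = "\<lambda>I. (I p, I(p := undefined))"])
    fix S assume S: "S \<in> ?S"
    then obtain J I where e: "S = (J, I)" "J \<subseteq> A" "I \<in> ordered_decompositions P (A - J)" by auto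
    have "I p = undefined"
      using e(3) assms(3) by (auto simp: ordered_decompositions_def PiE_def extensional_def)
    then have "I(p := undefined) = I" by (rule fun_upd_idem)
    then show "(\<lambda>I. (I p, I(p := undefined))) ((\<lambda>(J, I). I(p := J)) S) = S"
      by (simp add: e)
    show "(\<lambda>(J, I). I(p := J)) S \<in> ordered_decompositions (insert p P) A"
      using ordered_decompositions_upd[OF assms(3) e(2,3)] by (simp add: e)
  qed (use ordered_decompositions_remove[OF assms(3)] in auto)
  also have "\<dots> = (\<Sum>J\<in>Pow A. \<Sum>I\<in>ordered_decompositions P (A - J). F (I(p := J)))"
    using assms by (intro sum.Sigma[symmetric]) (auto intro: finite_ordered_decompositions)
  finally show ?thesis .
qed


section \<open>Products of primitive elements\<close>

lemma sum_Pow_insert: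
  assumes "finite A" "a \<notin> A"
  shows "(\<Sum>J\<in>Pow (insert a A). F J) = (\<Sum>J\<in>Pow A. F (insert a J) + F J)"
proof -
  have "inj_on (insert a) (Pow A)"
    using assms(2) by (intro inj_onI) (metis PowD insert_ident subsetD)
  moreover have "Pow A \<inter> insert a ` Pow A = {}" using assms(2) by auto
  ultimately show ?thesis
    using assms by (simp add: Pow_insert sum.union_disjoint sum.reindex sum.distrib add.commute)
qed

text \<open>
  Each factor is primitive, so it goes into either tensor factor of the coproduct independently of
  the others.
\<close>

lemma sweedler_prod_iota:
  assumes "finite A" "\<And>b. lin (\<lambda>a. g a b)" "\<And>a. lin (g a)"
  shows "sweedler g (coproduct (\<Prod>j\<in>A. iota (w j))) =
    (\<Sum>J\<in>Pow A. g (\<Prod>j\<in>J. iota (w j)) (\<Prod>j\<in>A - J. iota (w j)))"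
  using assms
proof (induction A arbitrary: g rule: finite_induct)
  case empty
  then show ?case by simp
next
  case (insert c A)
  note l = lin_comp[OF insert.prems(1)] lin_comp[OF insert.prems(2)]
  let ?g = "\<lambda>a b. g (iota (w c) * a) b + g a (iota (w c) * b)"
  have step: "?g (\<Prod>j\<in>J. iota (w j)) (\<Prod>j\<in>A - J. iota (w j)) =
      g (\<Prod>j\<in>insert c J. iota (w j)) (\<Prod>j\<in>insert c A - insert c J. iota (w j)) +
      g (\<Prod>j\<in>J. iota (w j)) (\<Prod>j\<in>insert c A - J. iota (w j))" if "J \<in> Pow A" for J
  proof -
    have "finite J" "c \<notin> J" using that insert.hyps finite_subset by auto
    moreover have "insert c A - insert c J = A - J" "insert c A - J = insert c (A - J)"
      using that insert.hyps(2) by auto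
    ultimately show ?thesis using insert.hyps by simp
  qed
  have "sweedler g (coproduct (\<Prod>j\<in>insert c A. iota (w j))) =
      sweedler ?g (coproduct (\<Prod>j\<in>A. iota (w j)))"
    using insert.hyps by (simp add: sweedler_iota[OF insert.prems])
  also have "\<dots> = (\<Sum>J\<in>Pow A. ?g (\<Prod>j\<in>J. iota (w j)) (\<Prod>j\<in>A - J. iota (w j)))"
    by (rule insert.IH; intro lin_plus l lin_intros insert.prems)
  also have "\<dots> = (\<Sum>J\<in>Pow (insert c A).
      g (\<Prod>j\<in>J. iota (w j)) (\<Prod>j\<in>insert c A - J. iota (w j)))"
    unfolding sum_Pow_insert[OF insert.hyps] by (rule sum.cong[OF refl step])
  finally show ?case .
qed

lemma counit_prod_iota:
  assumes "finite A"
  shows "counit (\<Prod>j\<in>A. iota (w j)) = (if A = {} then 1 else 0)"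
proof (cases "A = {}")
  case False
  then obtain a where "a \<in> A" by auto
  then show ?thesis
    by (simp add: prod.remove[OF assms] counit_iota False)
qed simp


section \<open>Shuffles over finite index sets and grafting\<close>

lemma foldr_shuffle_insort:
  "foldr (\<lambda>j t. shuffle (w j) t) (insort a js) t =
    shuffle (w a) (foldr (\<lambda>j t. shuffle (w j) t) js t)"
proof (induction js)
  case (Cons b js)
  have "shuffle (w b) (shuffle (w a) p) = shuffle (w a) (shuffle (w b) p)" for p
    by (metis shuffle_assoc shuffle_commute)
  then show ?case using Cons by simp
qed simp

lemma shuffle_family_empty [simp]: "shuffle_family w {} = bas []"
  by (simp add: shuffle_family_def)

lemma shuffle_family_insert:
  "finite A \<Longrightarrow> a \<notin> A \<Longrightarrow> shuffle_family w (insert a A) = shuffle (w a) (shuffle_family w A)"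
  unfolding shuffle_family_def by (simp add: foldr_shuffle_insort)

lemma lmap_funpow_letter:
  assumes "vector_space scale" "is_basis scale B" "Vector_Spaces.linear scale scale f"
  shows "(lmap scale B f ^^ n) (letter scale B x) = letter scale B ((f ^^ n) x)"
  by (induction n) (simp_all add: lmap_letter[OF assms])

lemma word_Cons: "word scale B (x # xs) = prepend (letter scale B x) (word scale B xs)"
  by (simp add: word_def)

context prelie_tensor
begin

lemma graft_prod_iota:
  assumes "finite J"
  shows "graft l (\<Prod>j\<in>J. iota (w j)) t =
    prepend ((phi ^^ card J) l) (shuffle t (shuffle_family w J))"
  using assms
proof (induction J arbitrary: l t rule: finite_induct)
  case (insert a J)
  then show ?case
    by (simp add: graft_iota shuffle_family_insert shuffle_assoc funpow_swap1)
qed simp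

lemma tens_bullet_Nil: "tens_bullet (bas []) z = pscale (counit z) (bas [])"
  by (simp add: tens_bullet_def)

text \<open>
  For a basis letter and a basis word this is the definition of \<open>word_bullet\<close>; both sides are
  bilinear in the letter and in the word.
\<close>

lemma tens_bullet_prepend:
  "tens_bullet (prepend l t) z =
    sweedler (\<lambda>a b. graft l a (tens_bullet t b)) (coproduct z)"
proof -
  have 1: "tens_bullet (prepend (bas a) (bas u)) z =
      sweedler (\<lambda>c b. graft (bas a) c (tens_bullet (bas u) b)) (coproduct z)" for a u
    by (simp add: tens_bullet_def)
  have 2: "tens_bullet (prepend l (bas u)) z =
      sweedler (\<lambda>c b. graft l c (tens_bullet (bas u) b)) (coproduct z)" for u
    by (rule lin_eqI[where p = l]) (intro lin_intros lin_tens_bullet lin_graft 1)+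
  show ?thesis
    by (rule lin_eqI[where p = t]) (intro lin_intros lin_tens_bullet lin_graft 2)+
qed

lemma tens_bullet_prepend_prod_iota:
  assumes "finite A"
  shows "tens_bullet (prepend l t) (\<Prod>j\<in>A. iota (w j)) =
    (\<Sum>J\<in>Pow A. prepend ((phi ^^ card J) l)
      (shuffle (tens_bullet t (\<Prod>j\<in>A - J. iota (w j))) (shuffle_family w J)))"
proof -
  have "tens_bullet (prepend l t) (\<Prod>j\<in>A. iota (w j)) =
      (\<Sum>J\<in>Pow A. graft l (\<Prod>j\<in>J. iota (w j)) (tens_bullet t (\<Prod>j\<in>A - J. iota (w j))))"
    unfolding tens_bullet_prepend
    by (rule sweedler_prod_iota[OF assms]; intro lin_graft lin_tens_bullet lin_id)
  then show ?thesis
    using assms by (simp add: graft_prod_iota finite_subset[of _ A])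
qed

lemma bullet_eq_ext: "bullet pl = ext"
  using oudom_guin_extension_unique[OF oudom_guin_extension_bullet oudom_guin_extension_ext] .

lemma bullet_iota: "bullet pl (iota t) z = iota (tens_bullet t z)"
  by (simp add: bullet_eq_ext ext_iota)

end


section \<open>The bullet and star products of a word with a product\<close>

lemma nested_cong:
  assumes "\<And>m. j \<le> m \<Longrightarrow> m \<le> i \<Longrightarrow> I m = I' m" "j \<le> i"
  shows "nested scale B f x w I i j = nested scale B f x w I' i j"
  using assms
proof (induction "i - j" arbitrary: j)
  case 0
  then have "\<not> j < i" "I j = I' j" by auto
  then show ?case by (simp add: nested.simps[of scale B f x w _ i j])
next
  case (Suc d)
  have "nested scale B f x w I i (Suc j) = nested scale B f x w I' i (Suc j)"
    by (rule Suc.hyps(1)) (use Suc in auto)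
  moreover have "I j = I' j" using Suc by auto
  ultimately show ?case by (simp add: nested.simps[of scale B f x w _ i j])
qed

text \<open>
  For \<open>j = i + 1\<close> no letter is left and the innermost bracket is the empty word, the unit of the
  shuffle product. With this convention the last letter needs no separate treatment.
\<close>

definition nested_tail ::
  "('k::field \<Rightarrow> 'v::ab_group_add \<Rightarrow> 'v) \<Rightarrow> 'v set \<Rightarrow> ('v \<Rightarrow> 'v) \<Rightarrow> (nat \<Rightarrow> 'v) \<Rightarrow>
    (nat \<Rightarrow> ('v, 'k) tens) \<Rightarrow> (nat \<Rightarrow> nat set) \<Rightarrow> nat \<Rightarrow> nat \<Rightarrow> ('v, 'k) tens" where
  "nested_tail scale B f x w I i j =
    (if j \<le> i then nested scale B f x w I i j else bas [])"

lemma nested_tail_step: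
  assumes "j \<le> i"
  shows "nested_tail scale B f x w I i j =
    prepend (letter scale B ((f ^^ card (I j)) (x j)))
      (shuffle (nested_tail scale B f x w I i (Suc j)) (shuffle_family w (I j)))"
  using assms by (simp add: nested_tail_def nested.simps[of scale B f x w I i j])

lemma nested_tail_upd:
  assumes "p < j \<or> i < p"
  shows "nested_tail scale B f x w (I(p := J)) i j = nested_tail scale B f x w I i j"
  unfolding nested_tail_def by (auto intro!: nested_cong simp: assms) (use assms in auto)

text \<open>
  Induction from the last letter to the first, with the index set arbitrary because splitting off
  the block of a letter leaves the complement for the remaining ones.
\<close>

lemma tens_bullet_word_prod_iota:
  fixes scale :: "'k::field \<Rightarrow> 'v::ab_group_add \<Rightarrow> 'v"
  assumes "vector_space scale" "is_basis scale B" "Vector_Spaces.linear scale scale f"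
    and "finite A" "j \<le> Suc i"
  shows "prelie_tensor.tens_bullet scale B f (word scale B (map x [j..<Suc i]))
      (\<Prod>m\<in>A. iota (w m)) =
    (\<Sum>I\<in>ordered_decompositions {j..i} A. nested_tail scale B f x w I i j)"
  using assms(5,4)
proof (induction j arbitrary: A rule: inc_induct)
  case base
  have "word scale B (map x [Suc i..<Suc i]) = bas []" by (simp add: word_def)
  then show ?case
    using base
    by (simp add: prelie_tensor.tens_bullet_Nil counit_prod_iota ordered_decompositions_empty
        nested_tail_def)
next
  case (step j)
  let ?T = "prelie_tensor.tens_bullet scale B f"
  let ?N = "\<lambda>I. nested_tail scale B f x w I i"
  let ?u = "word scale B (map x [Suc j..<Suc i])"
  let ?h = "\<lambda>J t. prepend (letter scale B ((f ^^ card J) (x j))) (shuffle t (shuffle_family w J))"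
  have j: "j \<le> i" using step.hyps by simp
  have h: "lin (?h J)" for J by (intro lin_intros)
  have "[j..<Suc i] = j # [Suc j..<Suc i]" using j by (simp add: upt_conv_Cons del: upt_Suc)
  then have "?T (word scale B (map x [j..<Suc i])) (\<Prod>m\<in>A. iota (w m)) =
      (\<Sum>J\<in>Pow A. ?h J (?T ?u (\<Prod>m\<in>A - J. iota (w m))))"
    by (simp add: word_Cons prelie_tensor.tens_bullet_prepend_prod_iota[OF step.prems]
        lmap_funpow_letter[OF assms(1-3)] del: upt_Suc)
  also have "\<dots> = (\<Sum>J\<in>Pow A. \<Sum>I\<in>ordered_decompositions {Suc j..i} (A - J).
      ?h J (?N I (Suc j)))"
    using step.prems by (intro sum.cong refl) (simp add: step.IH lin_sum[OF h] del: upt_Suc)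
  also have "\<dots> = (\<Sum>J\<in>Pow A. \<Sum>I\<in>ordered_decompositions {Suc j..i} (A - J). ?N (I(j := J)) j)"
    by (simp add: nested_tail_step[OF j] nested_tail_upd)
  also have "\<dots> = (\<Sum>I\<in>ordered_decompositions (insert j {Suc j..i}) A. ?N I j)"
    using step.prems by (intro sum_ordered_decompositions_insert[symmetric]) auto
  also have "insert j {Suc j..i} = {j..i}" using j by auto
  finally show ?case .
qed

lemma bullet_word_prod_iota:
  fixes scale :: "'k::field \<Rightarrow> 'v::ab_group_add \<Rightarrow> 'v"
  assumes "vector_space scale" "is_basis scale B" "Vector_Spaces.linear scale scale f"
    and "1 \<le> i" "finite A"
  shows "bullet (prelie scale B f) (iota (word scale B (map x [1..<Suc i])))
      (\<Prod>m\<in>A. iota (w m)) =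
    (\<Sum>I\<in>ordered_decompositions {1..i} A. iota (nested scale B f x w I i 1))"
  using assms(4) tens_bullet_word_prod_iota[OF assms(1-3,5), of 1 i x w]
  by (simp add: prelie_tensor.bullet_iota lin_sum[OF lin_iota[OF lin_id]] nested_tail_def
      del: upt_Suc)

text \<open>
  The first tensor factor of the coproduct is distributed over the letters. The second one is
  the block with index \<open>i + 1\<close>.
\<close>

lemma star_word_prod_iota:
  fixes scale :: "'k::field \<Rightarrow> 'v::ab_group_add \<Rightarrow> 'v"
  assumes "vector_space scale" "is_basis scale B" "Vector_Spaces.linear scale scale f"
    and "1 \<le> i" "finite A"
  shows "star (prelie scale B f) (iota (word scale B (map x [1..<Suc i])))
      (\<Prod>m\<in>A. iota (w m)) =
    (\<Sum>I\<in>ordered_decompositions {1..Suc i} A.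
      iota (nested scale B f x w I i 1) * (\<Prod>m\<in>I (Suc i). iota (w m)))"
proof -
  let ?y = "iota (word scale B (map x [1..<Suc i]))"
  let ?b = "bullet (prelie scale B f)"
  let ?F = "\<lambda>I. iota (nested scale B f x w I i 1) * (\<Prod>m\<in>I (Suc i). iota (w m))"
  have l: "lin (?b ?y)"
    using oudom_guin_extension_bullet[of scale B f] by (simp add: oudom_guin_extension_def)
  have "star (prelie scale B f) ?y (\<Prod>m\<in>A. iota (w m)) =
      sweedler (\<lambda>a b. ?b ?y b * a) (coproduct (\<Prod>m\<in>A. iota (w m)))"
    unfolding star_def by (rule sweedler_commute)
  also have "\<dots> = (\<Sum>J\<in>Pow A. ?b ?y (\<Prod>m\<in>A - J. iota (w m)) * (\<Prod>m\<in>J. iota (w m)))"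
    by (rule sweedler_prod_iota[OF assms(5)]; intro lin_times l lin_id)
  also have "\<dots> = (\<Sum>J\<in>Pow A. \<Sum>I\<in>ordered_decompositions {1..i} (A - J). ?F (I(Suc i := J)))"
  proof (intro sum.cong refl)
    fix J
    have "nested scale B f x w (I(Suc i := J)) i 1 = nested scale B f x w I i 1" for I
      using assms(4) by (intro nested_cong) auto
    then show "?b ?y (\<Prod>m\<in>A - J. iota (w m)) * (\<Prod>m\<in>J. iota (w m)) =
        (\<Sum>I\<in>ordered_decompositions {1..i} (A - J). ?F (I(Suc i := J)))"
      unfolding bullet_word_prod_iota[OF assms(1-4) finite_Diff[OF assms(5)]] sum_distrib_right
      by (simp only: fun_upd_same)
  qed
  also have "\<dots> = (\<Sum>I\<in>ordered_decompositions (insert (Suc i) {1..i}) A. ?F I)"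
    using assms(5) by (intro sum_ordered_decompositions_insert[symmetric]) auto
  also have "insert (Suc i) {1..i} = {1..Suc i}" by auto
  finally show ?thesis .
qed

theorem theorem13:
  fixes scale :: "'k::field_char_0 \<Rightarrow> 'v::ab_group_add \<Rightarrow> 'v"
    and B :: "'v set"
    and f :: "'v \<Rightarrow> 'v"
    and i k :: nat
    and x :: "nat \<Rightarrow> 'v"
    and w :: "nat \<Rightarrow> ('v, 'k) tens"
  assumes "vector_space scale"
    and "is_basis scale B"
    and "Vector_Spaces.linear scale scale f"
    and "1 \<le> i"
    and "\<And>j. j \<in> {1..k} \<Longrightarrow> w j \<in> tensor_space B"
  shows "bullet (prelie scale B f) (iota (word scale B (map x [1..<Suc i]))) (\<Prod>j\<in>{1..k}. iota (w j)) =
      (\<Sum>I\<in>decompositions i k. iota (nested scale B f x w I i 1)) \<and>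
    star (prelie scale B f) (iota (word scale B (map x [1..<Suc i]))) (\<Prod>j\<in>{1..k}. iota (w j)) =
      (\<Sum>I\<in>decompositions (Suc i) k.
        iota (nested scale B f x w I i 1) * (\<Prod>j\<in>I (Suc i). iota (w j)))"
  unfolding decompositions_eq
  using bullet_word_prod_iota[OF assms(1-4)] star_word_prod_iota[OF assms(1-4)] by blast

end
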